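(* Let $(S,d)$ be a complete, separable metric space equipped with an origin $0\in S$ and a scalar multiplication. Let $\boldsymbol{X}=(X_t)_{t\in\mathbb{Z}}$ be a stochastic process in $S$ (not necessarily stationary), and for integer $m\ge 0$ write $\boldsymbol{X}^{(m)}=(X_{-m},\ldots,X_m)$. Let $\alpha\in(0,\infty)$ and $V\in\mathcal{R}_{-\alpha}$. The following two statements are equivalent: (a) There exists $\mu^{(\infty)}\in M_{\boldsymbol{0}}(S^{\mathbb{Z}})$ such that $\mu^{(\infty)}(\{\boldsymbol{x}: x_0\neq 0\})>0$ and such that, as $u\to\infty$, $$\frac{1}{V(u)}\Pr[u^{-1}\boldsymbol{X}\in\,\cdot\,]\to\mu^{(\infty)}(\,\cdot\,)\quad\text{in } M_{\boldsymbol{0}}(S^{\mathbb{Z}}).$$ (b) For each nonnegative integer $m$, there exists a non-zero $\mu^{(m)}\in M_{\boldsymbol{0}^{(m)}}(S^{2m+1})$ such that, as $u\to\infty$, $$\frac{1}{V(u)}\Pr[u^{-1}\boldsymbol{X}^{(m)}\in\,\cdot\,]\to\mu^{(m)}(\,\cdot\,)\quad\text{in } M_{\boldsymbol{0}^{(m)}}(S^{2m+1}).$$ If $(X_t)_{t\in\mathbb{Z}}$ is strictly stationary, the condition $\mu^{(\infty)}(\{\boldsymbol{x}:x_0\neq 0\})>0$ in (a) is equivalent to the condition that $\mu^{(\infty)}$ is non-zero.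
   Context: Scalar multiplication: $S$ has a distinguished point $0$ (the origin), $S\neq\{0\}$, and a scalar multiplication on $S$ is a map $[0,\infty)\times S\to S:(\lambda,x)\mapsto\lambda x$ such that (i) $\lambda_1(\lambda_2x)=(\lambda_1\lambda_2)x$ for all $\lambda_1,\lambda_2\in[0,\infty)$, $x\in S$; (ii) $1x=x$ for $x\in S$; (iii) the map is continuous with respect to the product topology; (iv) if $x\in S\setminus\{0\}$ and $0\le\lambda_1<\lambda_2$, then $d(\lambda_1x,0)<d(\lambda_2x,0)$. Product spaces: $S^{\mathbb{Z}}$ is the space of sequences $(x_t)_{t\in\mathbb{Z}}$ in $S$; $S^{\{-m,\ldots,m\}}$ is identified with $S^{2m+1}$. These carry their product topologies, metrized for instance by $$d_\infty(\boldsymbol{x},\boldsymbol{y})=\sum_{t\in\mathbb{Z}}2^{-|t|}\frac{d(x_t,y_t)}{1+d(x_t,y_t)},\qquad d_m(\boldsymbol{x},\boldsymbol{y})=\sum_{t=-m}^m2^{-|t|}\frac{d(x_t,y_t)}{1+d(x_t,y_t)}.$$ Their origins are the zero sequence $\boldsymbol{0}\in S^{\mathbb{Z}}$ and $\boldsymbol{0}^{(m)}=(0,\ldots,0)\in S^{2m+1}$; scalar multiplication is defined componentwise. The notation $u^{-1}\boldsymbol{X}$ means scalar multiplication by $u^{-1}$. Measures: for a complete separable metric space $E$ with origin $o$, $M_o(E)$ is the space of Borel measures on $E\setminus\{o\}$ that are finite on complements of neighbourhoods of $o$. Convergence $\mu_n\to\mu$ in $M_o(E)$ means $\int f\,d\mu_n\to\int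 f\,d\mu$ for every bounded continuous $f:E\setminus\{o\}\to\mathbb{R}$ that vanishes on some open ball $\{x: \mathrm{dist}(x,o)<r\}$, $r>0$. Regularly varying functions: for $\tau\in\mathbb{R}$, $\mathcal{R}_\tau$ is the class of positive measurable functions $g$ defined in a neighbourhood of infinity such that $\lim_{u\to\infty}g(\lambda u)/g(u)=\lambda^\tau$ for every $\lambda\in(0,\infty)$. *)

theory Defs
  imports "HOL-Probability.Probability"
begin

section \<open>State space and regularly varying functions\<close>

locale scalar_multiplication =
  fixes origin :: "'a::metric_space" and smul :: "real \<Rightarrow> 'a \<Rightarrow> 'a"
  assumes nontrivial: "UNIV \<noteq> {origin}"
    and smul_assoc: "\<And>a b x. 0 \<le> a \<Longrightarrow> 0 \<le> b \<Longrightarrow> smul a (smul b x) = smul (a * b) x"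
    and smul_one: "\<And>x. smul 1 x = x"
    and smul_continuous: "continuous_on ({0..} \<times> UNIV) (\<lambda>(a, x). smul a x)"
    and smul_dist_less:
      "\<And>a b x. x \<noteq> origin \<Longrightarrow> 0 \<le> a \<Longrightarrow> a < b
         \<Longrightarrow> dist (smul a x) origin < dist (smul b x) origin"

text \<open>A function defined in a neighbourhood of infinity is represented by a total function
  of which only the values on some half-line \<open>{a<..}\<close> matter.\<close>

definition regularly_varying :: "real \<Rightarrow> (real \<Rightarrow> real) set" where
  "regularly_varying \<tau> =
     {g. (\<exists>a. (\<forall>u>a. g u > 0) \<and> g \<in> borel_measurable (restrict_space borel {a<..})) \<and>
         (\<forall>c>0. ((\<lambda>u. g (c * u) / g u) \<longlongrightarrow> c powr \<tau>) at_top)}"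

section \<open>Sequence spaces\<close>

text \<open>For \<open>I\<close> a set of integers, \<open>S\<^sup>I\<close> is the set \<open>\<Pi>\<^sub>E t\<in>I. UNIV\<close> of functions that
  are \<open>undefined\<close> outside \<open>I\<close>. The two cases of interest are \<open>I = UNIV\<close>, where this is
  the type \<open>int \<Rightarrow> 'a\<close>, and \<open>I = window m\<close>, where it plays the role of the \<open>(2m+1)\<close>-fold
  product and the sum in \<open>seq_dist\<close> is finite.\<close>

definition window :: "nat \<Rightarrow> int set" where
  "window m = {- int m..int m}"

definition seq_dist :: "int set \<Rightarrow> (int \<Rightarrow> 'a::metric_space) \<Rightarrow> (int \<Rightarrow> 'a) \<Rightarrow> real" where
  "seq_dist I x y =
     (\<Sum>\<^sub>\<infinity>t\<in>I. 2 powi (- \<bar>t\<bar>) * (dist (x t) (y t) / (1 + dist (x t) (y t))))"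

definition seq_metric :: "int set \<Rightarrow> (int \<Rightarrow> 'a::metric_space) metric" where
  "seq_metric I = metric (\<Pi>\<^sub>E t\<in>I. UNIV, seq_dist I)"

definition seq_origin :: "int set \<Rightarrow> 'a \<Rightarrow> int \<Rightarrow> 'a" where
  "seq_origin I origin = (\<lambda>t\<in>I. origin)"

definition seq_smul :: "int set \<Rightarrow> (real \<Rightarrow> 'a \<Rightarrow> 'a) \<Rightarrow> real \<Rightarrow> (int \<Rightarrow> 'a) \<Rightarrow> int \<Rightarrow> 'a" where
  "seq_smul I smul c x = (\<lambda>t\<in>I. smul c (x t))"

text \<open>\<open>seq_dist I\<close> is indeed a metric on \<open>S\<^sup>I\<close>, and it induces the product topology.\<close>

abbreviation (input) bdist :: "'a::metric_space \<Rightarrow> 'a \<Rightarrow> real" where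
  "bdist a b \<equiv> dist a b / (1 + dist a b)"

lemma bdist_bounds: "0 \<le> bdist a b" "bdist a b \<le> 1"
  using zero_le_dist[of a b] by (auto simp: divide_simps simp del: zero_le_dist)

lemma frac_mono: "x / (1 + x) \<le> y / (1 + y)" if "0 \<le> x" "x \<le> y" for x y :: real
  using that by (simp add: divide_simps algebra_simps)

lemma bdist_triangle: "bdist a c \<le> bdist a b + bdist b c"
proof -
  have "bdist a c \<le> (dist a b + dist b c) / (1 + (dist a b + dist b c))"
    by (intro frac_mono zero_le_dist dist_triangle)
  also have "\<dots> = dist a b / (1 + (dist a b + dist b c)) + dist b c / (1 + (dist a b + dist b c))"
    by (rule add_divide_distrib)
  also have "\<dots> \<le> bdist a b + bdist b c"
    by (intro add_mono divide_left_mono mult_pos_pos) (auto simp: add_pos_nonneg)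
  finally show ?thesis .
qed

lemma summable_on_weight: "(\<lambda>t::int. 2 powi (- \<bar>t\<bar>) :: real) summable_on I"
proof -
  let ?w = "\<lambda>t::int. 2 powi (- \<bar>t\<bar>) :: real"
  have w: "?w (int n) = (1/2) ^ n" "?w (- int n) = (1/2) ^ n" for n
    by (simp_all add: power_int_minus power_one_over inverse_eq_divide)
  have geo: "(\<lambda>n. (1/2::real) ^ n) summable_on A" for A :: "nat set"
    by (rule summable_on_subset_banach[of _ UNIV])
      (auto intro!: summable_nonneg_imp_summable_on summable_geometric)
  have pos: "?w summable_on (int ` UNIV)"
    by (subst summable_on_reindex) (simp_all only: o_def w(1) geo inj_of_nat)
  have neg: "?w summable_on ((\<lambda>n. - int n) ` {1..})"
    by (subst summable_on_reindex) (simp_all only: o_def w(2) geo, simp add: inj_on_def)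
  have "t \<in> int ` UNIV \<union> (\<lambda>n. - int n) ` {1..}" for t :: int
    by (cases "t \<ge> 0") (auto simp: image_iff intro: nonneg_int_cases bexI[of _ "nat (- t)"])
  then have un: "int ` UNIV \<union> (\<lambda>n. - int n) ` {1..} = UNIV"
    by blast
  have "?w summable_on (int ` UNIV \<union> (\<lambda>n. - int n) ` {1..})"
    by (intro summable_on_Un_disjoint pos neg) auto
  then show ?thesis
    unfolding un by (rule summable_on_subset_banach) simp
qed

lemma seq_dist_summable:
  "(\<lambda>t. 2 powi (- \<bar>t\<bar>) * bdist (x t) (y t)) summable_on I"
proof -
  have "norm (2 powi (- \<bar>t\<bar>) * bdist (x t) (y t)) \<le> 2 powi (- \<bar>t\<bar>)" for t
    unfolding real_norm_def abs_mult abs_of_nonneg[OF bdist_bounds(1)]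
    by (simp only: abs_of_nonneg[OF zero_le_power_int[OF zero_le_numeral]])
      (intro mult_left_le bdist_bounds zero_le_power_int zero_le_numeral)
  then have "(\<lambda>t. norm (2 powi (- \<bar>t\<bar>) * bdist (x t) (y t))) summable_on I"
    by (rule Infinite_Sum.abs_summable_on_comparison_test'[OF summable_on_weight])
  then show ?thesis
    by (rule abs_summable_summable)
qed

lemma seq_dist_ge:
  assumes "t \<in> I"
  shows "2 powi (- \<bar>t\<bar>) * bdist (x t) (y t) \<le> seq_dist I x y"
proof -
  have "(\<Sum>t\<in>{t}. 2 powi (- \<bar>t\<bar>) * bdist (x t) (y t)) \<le> seq_dist I x y"
    unfolding seq_dist_def
    by (rule finite_sum_le_infsum) (use assms seq_dist_summable bdist_bounds(1) in auto)
  then show ?thesis by simp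
qed

lemma Metric_space_seq_dist:
  "Metric_space (\<Pi>\<^sub>E t\<in>I. UNIV) (seq_dist I :: (int \<Rightarrow> 'a::metric_space) \<Rightarrow> _)"
proof
  fix x y z :: "int \<Rightarrow> 'a"
  show "0 \<le> seq_dist I x y"
    unfolding seq_dist_def by (rule infsum_nonneg) (use bdist_bounds(1) in auto)
  show "seq_dist I x y = seq_dist I y x"
    by (simp add: seq_dist_def dist_commute)
  assume x: "x \<in> (\<Pi>\<^sub>E t\<in>I. UNIV)" and y: "y \<in> (\<Pi>\<^sub>E t\<in>I. UNIV)"
  show "seq_dist I x y = 0 \<longleftrightarrow> x = y"
  proof
    assume 0: "seq_dist I x y = 0"
    have "x t = y t" if "t \<in> I" for t
    proof -
      have "0 < (2::real) powi (- \<bar>t\<bar>)"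
        by (rule zero_less_power_int) simp
      then have "bdist (x t) (y t) \<le> 0"
        using seq_dist_ge[OF that, of x y] 0 by (metis mult_pos_pos not_le)
      moreover have "0 < 1 + dist (x t) (y t)"
        by (simp add: add_pos_nonneg)
      ultimately show ?thesis
        by (simp add: divide_le_0_iff)
    qed
    then show "x = y"
      using x y by (rule_tac PiE_ext) auto
  qed (simp add: seq_dist_def)
  show "seq_dist I x z \<le> seq_dist I x y + seq_dist I y z"
    unfolding seq_dist_def
    by (subst infsum_add[symmetric, OF seq_dist_summable seq_dist_summable])
      (intro infsum_mono summable_on_add seq_dist_summable;
        metis bdist_triangle distrib_left mult_left_mono zero_le_power_int zero_le_numeral)
qed

lemma mspace_seq_metric [simp]: "mspace (seq_metric I) = (\<Pi>\<^sub>E t\<in>I. UNIV)"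
  unfolding seq_metric_def by (rule Metric_space.mspace_metric[OF Metric_space_seq_dist])

lemma mdist_seq_metric [simp]: "mdist (seq_metric I) = seq_dist I"
  unfolding seq_metric_def by (rule Metric_space.mdist_metric[OF Metric_space_seq_dist])

lemma mtopology_of_seq_metric:
  "mtopology_of (seq_metric I :: (int \<Rightarrow> 'a::metric_space) metric) = product_topology (\<lambda>_. euclidean) I"
    (is "?T = ?P")
proof -
  interpret Metric_space "(\<Pi>\<^sub>E t\<in>I. UNIV) :: (int \<Rightarrow> 'a) set" "seq_dist I"
    by (rule Metric_space_seq_dist)
  have T: "?T = mtopology"
    by (simp add: seq_metric_def)
  have w: "0 < (2::real) powi k" for k
    by (rule zero_less_power_int) simp
  have proj: "continuous_map mtopology euclidean (\<lambda>x. x t)" if t: "t \<in> I" for t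
    unfolding mtopology_is_euclidean[symmetric]
    unfolding metric_continuous_map[OF Met_TC.Metric_space_axioms]
  proof (intro conjI ballI allI impI)
    fix x and e :: real assume "x \<in> (\<Pi>\<^sub>E t\<in>I. (UNIV :: 'a set))" and e: "0 < e"
    let ?d = "2 powi (- \<bar>t\<bar>) * (e / (1 + e))"
    have "dist (x t) (y t) < e" if "seq_dist I x y < ?d" for y
    proof (rule ccontr)
      assume "\<not> ?thesis"
      then have "e / (1 + e) \<le> bdist (x t) (y t)"
        using e by (intro frac_mono) auto
      then have "?d \<le> 2 powi (- \<bar>t\<bar>) * bdist (x t) (y t)"
        by (intro mult_left_mono less_imp_le[OF w])
      then show False
        using seq_dist_ge[OF t, of x y] that by linarith
    qed
    moreover have "0 < ?d"
      using e w by (intro mult_pos_pos divide_pos_pos) auto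
    ultimately show "\<exists>\<delta>>0. \<forall>y. y \<in> (\<Pi>\<^sub>E t\<in>I. UNIV) \<and> seq_dist I x y < \<delta> \<longrightarrow> dist (x t) (y t) < e"
      by blast
  qed auto
  have 1: "continuous_map mtopology ?P id"
    unfolding continuous_map_componentwise using proj by (auto simp: PiE_iff)
  have 2: "continuous_map ?P mtopology id"
    unfolding continuous_map_to_metric
  proof (intro ballI allI impI)
    fix x and e :: real assume x: "x \<in> topspace ?P" and e: "0 < e"
    let ?f = "\<lambda>y t. 2 powi (- \<bar>t\<bar>) * bdist (x t) (y t)"
    obtain F where F: "finite F" "F \<subseteq> I"
      and Fe: "norm (sum (\<lambda>t. 2 powi (- \<bar>t\<bar>) :: real) F - infsum (\<lambda>t. 2 powi (- \<bar>t\<bar>)) I) \<le> e/4"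
      using infsum_finite_approximation[OF summable_on_weight[of I], of "e/4"] e
      by (auto simp: dist_norm)
    have tail: "infsum (\<lambda>t. 2 powi (- \<bar>t\<bar>) :: real) (I - F) \<le> e/4"
    proof -
      have "infsum (\<lambda>t. 2 powi (- \<bar>t\<bar>) :: real) (I - F) = infsum (\<lambda>t. 2 powi (- \<bar>t\<bar>)) I - infsum (\<lambda>t. 2 powi (- \<bar>t\<bar>)) F"
        using F summable_on_weight by (intro infsum_Diff) auto
      then show ?thesis
        using abs_le_D2[OF Fe[unfolded real_norm_def]] F(1) by simp
    qed
    define U where "U = {y \<in> topspace ?P. sum (?f y) F \<in> {..<e/2}}"
    have "continuous_map ?P euclideanreal (\<lambda>y. sum (?f y) F)"
    proof (rule continuous_map_sum)
      fix t assume "t \<in> F"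
      then have t: "t \<in> I" using F by auto
      have c: "continuous_map euclidean euclideanreal (\<lambda>a. 2 powi (- \<bar>t\<bar>) * bdist (x t) a)"
        by (simp, intro continuous_intros) (metis add_nonneg_eq_0_iff zero_le_dist zero_le_one zero_neq_one)
      show "continuous_map ?P euclideanreal (\<lambda>y. ?f y t)"
        using continuous_map_compose[OF continuous_map_product_projection[OF t] c] by (simp add: o_def)
    qed (rule F)
    then have "openin ?P U"
      unfolding U_def by (rule openin_continuous_map_preimage) (simp add: open_lessThan)
    moreover have "x \<in> U"
      using x e by (simp add: U_def)
    moreover have "id y \<in> mball (id x) e" if "y \<in> U" for y
    proof -
      have "seq_dist I x y = infsum (?f y) F + infsum (?f y) (I - F)"
        unfolding seq_dist_def
        using infsum_Un_disjoint[of "?f y" F "I - F"] F seq_dist_summable[of x y]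
        by (simp add: Un_absorb1)
      also have "infsum (?f y) (I - F) \<le> infsum (\<lambda>t. 2 powi (- \<bar>t\<bar>) :: real) (I - F)"
        by (intro infsum_mono seq_dist_summable summable_on_weight mult_left_le bdist_bounds less_imp_le[OF w])
      finally have "seq_dist I x y < e"
        using tail that F e by (simp add: U_def)
      then show ?thesis
        using x that by (simp add: U_def)
    qed
    ultimately show "\<exists>U. openin ?P U \<and> x \<in> U \<and> (\<forall>y\<in>U. id y \<in> mball (id x) e)"
      by blast
  qed
  have "topspace mtopology = topspace ?P" by simp
  then have "openin mtopology U \<longleftrightarrow> openin ?P U" for U
    using openin_continuous_map_preimage[OF 1, of U] openin_continuous_map_preimage[OF 2, of U]
      openin_subset[of mtopology U] openin_subset[of ?P U]
    by (auto simp: Collect_conj_eq Int_absorb1 simp del: topspace_mtopology topspace_product_topology)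
  then show ?thesis
    by (simp add: T topology_eq)
qed

section \<open>The space of measures and its convergence\<close>

definition borel_of :: "'e topology \<Rightarrow> 'e measure" where
  "borel_of T = sigma (topspace T) {U. openin T U}"

definition punctured :: "'e metric \<Rightarrow> 'e \<Rightarrow> 'e topology" where
  "punctured E z = subtopology (mtopology_of E) (mspace E - {z})"

text \<open>Open neighbourhoods suffice, as every neighbourhood contains an open one.\<close>

definition M0 :: "'e metric \<Rightarrow> 'e \<Rightarrow> 'e measure set" where
  "M0 E z = {\<mu>. sets \<mu> = sets (borel_of (punctured E z)) \<and>
                (\<forall>U. openin (mtopology_of E) U \<and> z \<in> U \<longrightarrow> emeasure \<mu> (mspace E - U) < \<infinity>)}"

definition M0_tendsto ::
    "'e metric \<Rightarrow> 'e \<Rightarrow> ('i \<Rightarrow> 'e measure) \<Rightarrow> 'e measure \<Rightarrow> 'i filter \<Rightarrow> bool" where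
  "M0_tendsto E z N \<mu> F \<longleftrightarrow>
     (\<forall>f :: 'e \<Rightarrow> real.
        continuous_map (punctured E z) euclideanreal f \<and>
        bounded (f ` (mspace E - {z})) \<and>
        (\<exists>r>0. \<forall>x \<in> mspace E - {z}. mdist E x z < r \<longrightarrow> f x = 0)
        \<longrightarrow> ((\<lambda>u. \<integral>x. f x \<partial>N u) \<longlongrightarrow> (\<integral>x. f x \<partial>\<mu>)) F)"

section \<open>Stochastic processes\<close>

definition strictly_stationary :: "'w measure \<Rightarrow> (int \<Rightarrow> 'w \<Rightarrow> 'a::topological_space) \<Rightarrow> bool" where
  "strictly_stationary P X \<longleftrightarrow>
     (\<forall>h. \<forall>J. finite J \<longrightarrow>
        distr P (\<Pi>\<^sub>M t\<in>J. borel) (\<lambda>\<omega>. \<lambda>t\<in>J. X (t + h) \<omega>) =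
        distr P (\<Pi>\<^sub>M t\<in>J. borel) (\<lambda>\<omega>. \<lambda>t\<in>J. X t \<omega>))"

text \<open>The measure \<open>V(u)\<^sup>-\<^sup>1 Pr[u\<^sup>-\<^sup>1 (X\<^sub>t)\<^sub>t\<^sub>\<in>\<^sub>I \<in> \<cdot>]\<close> on the punctured space. It is only
  meaningful for large \<open>u\<close>, where \<open>u > 0\<close> and \<open>V u > 0\<close>.\<close>

definition tail_measure ::
    "'w measure \<Rightarrow> (int \<Rightarrow> 'w \<Rightarrow> 'a::metric_space) \<Rightarrow> (real \<Rightarrow> 'a \<Rightarrow> 'a) \<Rightarrow> 'a \<Rightarrow> (real \<Rightarrow> real)
      \<Rightarrow> int set \<Rightarrow> real \<Rightarrow> (int \<Rightarrow> 'a) measure" where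
  "tail_measure P X smul origin V I u =
     scale_measure (ennreal (1 / V u))
       (restrict_space
         (distr P (borel_of (mtopology_of (seq_metric I)))
           (\<lambda>\<omega>. seq_smul I smul (inverse u) (\<lambda>t\<in>I. X t \<omega>)))
         (mspace (seq_metric I) - {seq_origin I origin}))"

end

theory Submission
  imports Defs
begin

text \<open>All sequence spaces are embedded into the type \<open>int \<Rightarrow> 'a\<close>, those over a window by filling up
  with the origin; convergence is then tested on bounded continuous cylinder functions vanishing
  near the origin. A limit over all of \<open>\<int>\<close> is also a limit over each window, so (a) implies (b).

  For the converse, limits are unique, so the limits over the windows are consistent as functionals
  on test functions. The functions \<open>h\<^sub>n = min 1 (max 0 (n d\<^sub>n(x, 0) - 1))\<close>, where \<open>d\<^sub>n\<close> is the
  distance over the window \<open>n\<close>, increase to 1 off the origin. Weighting the window limits by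
  \<open>g\<^sub>n = h\<^bsub>n+1\<^esub> - h\<^sub>n\<close> yields consistent finite measures, to which Kolmogorov's extension theorem
  applies, and the sum of the extensions over \<open>n\<close> is the required measure. Convergence to it follows
  since every nonnegative test function \<open>h\<close> is the increasing limit of the cylinder test functions
  \<open>x \<mapsto> inf\<^sub>y (h y + k d\<^sub>k(x, y))\<close>; this gives a lower bound for the limit, and a cylinder
  function dominating the given one turns it into convergence.

  If \<open>X\<close> is stationary, all coordinates of the limit have the same null sets off the origin.\<close>

subsection \<open>The metrics on sequences\<close>

lemma seq_dist_restrict [simp]: "seq_dist J (restrict x J) (restrict y J) = seq_dist J x y"
  unfolding seq_dist_def by (rule infsum_cong) simp

lemma seq_dist_cong:
  assumes "\<And>t. t \<in> J \<Longrightarrow> x t = x' t" "\<And>t. t \<in> J \<Longrightarrow> y t = y' t"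
  shows "seq_dist J x y = seq_dist J x' y'"
  unfolding seq_dist_def by (rule infsum_cong) (simp add: assms)

lemma seq_dist_nonneg [simp]: "0 \<le> seq_dist J x y"
  using Metric_space.nonneg[OF Metric_space_seq_dist] .

lemma seq_dist_commute: "seq_dist J x y = seq_dist J y x"
  using Metric_space.commute[OF Metric_space_seq_dist] .

lemma seq_dist_refl [simp]: "seq_dist J x x = 0"
  by (simp add: seq_dist_def)

text \<open>The metric axioms are available on functions that are \<open>undefined\<close> outside
  \<open>J\<close>. As \<open>seq_dist J\<close> ignores values outside \<open>J\<close>,
  restricting all arguments carries them over to total functions, where \<open>seq_dist J\<close> is
  a pseudometric.\<close>

lemma seq_dist_triangle: "seq_dist J x z \<le> seq_dist J x y + seq_dist J y z"
  using Metric_space.triangle[OF Metric_space_seq_dist, of "restrict x J" J "restrict y J" "restrict z J"]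
  by simp

lemma seq_dist_eq_0: "seq_dist J x y = 0 \<longleftrightarrow> (\<forall>t\<in>J. x t = y t)"
proof -
  have "seq_dist J x y = 0 \<longleftrightarrow> restrict x J = restrict y J"
    using Metric_space.zero[OF Metric_space_seq_dist, of "restrict x J" J "restrict y J"]
    by (simp add: restrict_PiE_iff)
  then show ?thesis
    by (metis restrict_apply' restrict_ext)
qed

lemma seq_dist_split:
  assumes "J \<subseteq> K"
  shows "seq_dist K x y = seq_dist J x y + seq_dist (K - J) x y"
  unfolding seq_dist_def
  using infsum_Un_disjoint[OF seq_dist_summable[of x y J] seq_dist_summable[of x y "K - J"]] assms
  by (simp add: Un_absorb1)

lemma seq_dist_mono: "J \<subseteq> K \<Longrightarrow> seq_dist J x y \<le> seq_dist K x y"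
  using seq_dist_split[of J K x y] by simp

lemma window_mono: "m \<le> n \<Longrightarrow> window m \<subseteq> window n"
  by (auto simp: window_def)

lemma finite_window [simp]: "finite (window m)"
  by (simp add: window_def)

lemma finite_subset_window:
  assumes "finite F" obtains m where "F \<subseteq> window m"
proof
  show "F \<subseteq> window (nat (\<Sum>t\<in>F. \<bar>t\<bar>))"
  proof
    fix t assume "t \<in> F"
    then have "\<bar>t\<bar> \<le> (\<Sum>t\<in>F. \<bar>t\<bar>)"
      using assms by (intro member_le_sum) auto
    then show "t \<in> window (nat (\<Sum>t\<in>F. \<bar>t\<bar>))"
      by (simp add: window_def abs_le_iff)
  qed
qed

text \<open>Each quotient in the metric is at most 1, so the terms outside a window add at most a
  tail of the summable weights. The window therefore depends on \<open>r\<close> alone and serves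
  all pairs of sequences.\<close>

lemma seq_dist_tail:
  assumes "0 < r"
  obtains m where "\<And>x y :: int \<Rightarrow> 'a::metric_space. seq_dist UNIV x y \<le> seq_dist (window m) x y + r"
proof -
  let ?w = "\<lambda>t::int. 2 powi (- \<bar>t\<bar>) :: real"
  obtain F where F: "finite F" and Fe: "dist (sum ?w F) (infsum ?w UNIV) \<le> r"
    using infsum_finite_approximation[OF summable_on_weight[of UNIV] assms] by auto
  obtain m where m: "F \<subseteq> window m"
    using finite_subset_window[OF F] .
  have "seq_dist UNIV x y \<le> seq_dist (window m) x y + r" for x y :: "int \<Rightarrow> 'a"
  proof -
    have "seq_dist (- window m) x y \<le> infsum ?w (- window m)"
      unfolding seq_dist_def
      by (intro infsum_mono seq_dist_summable summable_on_weight mult_left_le bdist_bounds) simp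
    also have "\<dots> \<le> infsum ?w (- F)"
      using m by (intro infsum_mono_neutral summable_on_weight) auto
    also have "\<dots> = infsum ?w UNIV - sum ?w F"
      using infsum_Diff[OF summable_on_weight[of UNIV] summable_on_weight[of F]] F
      by (simp add: Compl_eq_Diff_UNIV)
    also have "\<dots> \<le> r"
      using Fe by (simp add: dist_real_def)
    finally show ?thesis
      using seq_dist_split[of "window m" UNIV x y] by (simp add: Compl_eq_Diff_UNIV)
  qed
  then show ?thesis
    by (rule that)
qed

lemma continuous_map_restrict: "continuous_map euclidean (product_topology (\<lambda>_. euclidean) J)
    (\<lambda>x::int \<Rightarrow> 'a::topological_space. restrict x J)"
  unfolding continuous_map_componentwise
  using continuous_map_product_projection[of _ UNIV "\<lambda>_. euclidean :: 'a topology"]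
  by (auto simp: euclidean_product_topology)

text \<open>The distance factors through restriction to \<open>J\<close>, which is continuous into
  the product topology, and that topology is the one metrized by
  \<open>seq_metric J\<close>.\<close>

lemma continuous_on_seq_dist [continuous_intros]:
  "continuous_on A (\<lambda>x. seq_dist J x y)" for y :: "int \<Rightarrow> 'a::metric_space"
proof -
  have "continuous_map euclidean euclidean
      (\<lambda>x. mdist (seq_metric J) (restrict x J) (restrict y J))"
    by (intro continuous_map_mdist)
      (simp_all add: mtopology_of_seq_metric continuous_map_restrict)
  then have "continuous_on UNIV (\<lambda>x. seq_dist J x y)"
    by simp
  then show ?thesis
    by (rule continuous_on_subset) simp
qed

lemma seq_dist_open:
  assumes "open W" "x \<in> W"
  obtains r where "r > 0" "\<And>y. seq_dist UNIV x y < r \<Longrightarrow> y \<in> W"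
proof -
  interpret Metric_space "UNIV :: (int \<Rightarrow> 'a::metric_space) set" "seq_dist UNIV"
    using Metric_space_seq_dist[of UNIV] by simp
  have "mtopology = mtopology_of (seq_metric UNIV)"
    by (simp add: mtopology_of_def)
  also have "\<dots> = (euclidean :: (int \<Rightarrow> 'a) topology)"
    by (simp add: mtopology_of_seq_metric euclidean_product_topology)
  finally have "openin mtopology W"
    using assms by simp
  then show ?thesis
    unfolding openin_mtopology using assms that by (auto simp: subset_iff in_mball)
qed

lemma measurable_seq_dist [measurable]:
  "(\<lambda>x. seq_dist J x y) \<in> borel_measurable borel" for y :: "int \<Rightarrow> 'a::metric_space"
  by (intro borel_measurable_continuous_onI continuous_intros)

subsection \<open>Test functions\<close>

text \<open>Functions on the product over \<open>J\<close> are represented by total functions that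
  read only the coordinates in \<open>J\<close>, so that inclusion of index sets becomes inclusion
  of function classes. As they vanish near the origin, they can live on the unpunctured
  space.\<close>

definition test_fun :: "int set \<Rightarrow> 'a::metric_space \<Rightarrow> ((int \<Rightarrow> 'a) \<Rightarrow> real) set" where
  "test_fun J z =
     {f. continuous_on UNIV f \<and> (\<exists>C. \<forall>x. \<bar>f x\<bar> \<le> C) \<and>
         (\<forall>x y. (\<forall>t\<in>J. x t = y t) \<longrightarrow> f x = f y) \<and>
         (\<exists>r>0. \<forall>x. seq_dist J x (\<lambda>_. z) < r \<longrightarrow> f x = 0)}"

lemma test_funI:
  assumes "continuous_on UNIV f" "\<And>x. \<bar>f x\<bar> \<le> C" "\<And>x y. (\<And>t. t \<in> J \<Longrightarrow> x t = y t) \<Longrightarrow> f x = f y"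
    "r > 0" "\<And>x. seq_dist J x (\<lambda>_. z) < r \<Longrightarrow> f x = 0"
  shows "f \<in> test_fun J z"
  using assms unfolding test_fun_def by blast

lemma test_funE:
  assumes "f \<in> test_fun J z"
  obtains C r where "continuous_on UNIV f" "0 \<le> C" "\<And>x. \<bar>f x\<bar> \<le> C"
    "\<And>x y. (\<And>t. t \<in> J \<Longrightarrow> x t = y t) \<Longrightarrow> f x = f y"
    "r > 0" "\<And>x. seq_dist J x (\<lambda>_. z) < r \<Longrightarrow> f x = 0"
proof -
  obtain C r where "continuous_on UNIV f" "\<forall>x. \<bar>f x\<bar> \<le> C" "r > 0"
      "\<forall>x y. (\<forall>t\<in>J. x t = y t) \<longrightarrow> f x = f y" "\<forall>x. seq_dist J x (\<lambda>_. z) < r \<longrightarrow> f x = 0"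
    using assms unfolding test_fun_def by blast
  then show ?thesis
    by (intro that[of "max 0 C" r]) (auto simp: le_max_iff_disj)
qed

text \<open>More coordinates enlarge the distance, hence the ball over \<open>K\<close> about the
  origin lies inside the ball over \<open>J\<close> of the same radius.\<close>

lemma test_fun_mono:
  assumes "f \<in> test_fun J z" "J \<subseteq> K"
  shows "f \<in> test_fun K z"
  using assms(1)
proof (rule test_funE)
  fix C r assume *: "continuous_on UNIV f" "0 \<le> C" "\<And>x. \<bar>f x\<bar> \<le> C"
    "\<And>x y. (\<And>t. t \<in> J \<Longrightarrow> x t = y t) \<Longrightarrow> f x = f y"
    "r > 0" "\<And>x. seq_dist J x (\<lambda>_. z) < r \<Longrightarrow> f x = 0"
  show ?thesis
  proof (rule test_funI[OF *(1) *(3) _ *(5)])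
    show "f x = f y" if "\<And>t. t \<in> K \<Longrightarrow> x t = y t" for x y
      using that assms(2) by (intro *(4)) auto
    show "f x = 0" if "seq_dist K x (\<lambda>_. z) < r" for x
      using that seq_dist_mono[OF assms(2), of x "\<lambda>_. z"] by (intro *(6)) linarith
  qed
qed

text \<open>Only \<open>f\<close> has to vanish near the origin: a test function localizes any
  bounded continuous cylinder function.\<close>

lemma test_fun_mult:
  assumes "f \<in> test_fun J z"
    and g: "continuous_on UNIV g" "\<And>x. \<bar>g x\<bar> \<le> B" "\<And>x y. (\<And>t. t \<in> J \<Longrightarrow> x t = y t) \<Longrightarrow> g x = g y"
  shows "(\<lambda>x. f x * g x) \<in> test_fun J z"
  using assms(1)
proof (rule test_funE)
  fix C r assume *: "continuous_on UNIV f" "0 \<le> C" "\<And>x. \<bar>f x\<bar> \<le> C"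
    "\<And>x y. (\<And>t. t \<in> J \<Longrightarrow> x t = y t) \<Longrightarrow> f x = f y"
    "r > 0" "\<And>x. seq_dist J x (\<lambda>_. z) < r \<Longrightarrow> f x = 0"
  show ?thesis
  proof (rule test_funI[OF _ _ _ *(5)])
    show "continuous_on UNIV (\<lambda>x. f x * g x)"
      by (intro continuous_intros * g)
    show "\<bar>f x * g x\<bar> \<le> C * B" for x
      unfolding abs_mult by (intro mult_mono * g) auto
    show "f x * g x = f y * g y" if "\<And>t. t \<in> J \<Longrightarrow> x t = y t" for x y
      using *(4)[OF that] g(3)[OF that] by simp
  qed (use *(6) in auto)
qed

lemma test_fun_add:
  assumes "f \<in> test_fun J z" "g \<in> test_fun J z"
  shows "(\<lambda>x. f x + g x) \<in> test_fun J z"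
  using assms(1)
proof (rule test_funE)
  fix C r assume *: "continuous_on UNIV f" "0 \<le> C" "\<And>x. \<bar>f x\<bar> \<le> C"
    "\<And>x y. (\<And>t. t \<in> J \<Longrightarrow> x t = y t) \<Longrightarrow> f x = f y"
    "r > 0" "\<And>x. seq_dist J x (\<lambda>_. z) < r \<Longrightarrow> f x = 0"
  from assms(2) show ?thesis
  proof (rule test_funE)
    fix C' r' assume g: "continuous_on UNIV g" "0 \<le> C'" "\<And>x. \<bar>g x\<bar> \<le> C'"
      "\<And>x y. (\<And>t. t \<in> J \<Longrightarrow> x t = y t) \<Longrightarrow> g x = g y"
      "r' > 0" "\<And>x. seq_dist J x (\<lambda>_. z) < r' \<Longrightarrow> g x = 0"
    show ?thesis
    proof (rule test_funI[of _ "C + C'" J "min r r'"])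
      show "continuous_on UNIV (\<lambda>x. f x + g x)"
        by (intro continuous_intros * g)
      show "\<bar>f x + g x\<bar> \<le> C + C'" for x
        by (rule order_trans[OF abs_triangle_ineq add_mono[OF *(3) g(3)]])
      show "f x + g x = f y + g y" if "\<And>t. t \<in> J \<Longrightarrow> x t = y t" for x y
        using *(4)[OF that] g(4)[OF that] by simp
    qed (use *(5,6) g(5,6) in auto)
  qed
qed

lemma test_fun_cmult:
  assumes "f \<in> test_fun J z"
  shows "(\<lambda>x. c * f x) \<in> test_fun J z"
  using test_fun_mult[OF assms, of "\<lambda>_. c" "\<bar>c\<bar>"] by (simp add: mult.commute)

lemma test_fun_diff:
  assumes "f \<in> test_fun J z" "g \<in> test_fun J z"
  shows "(\<lambda>x. f x - g x) \<in> test_fun J z"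
  using test_fun_add[OF assms(1) test_fun_cmult[OF assms(2), of "-1"]] by simp

lemma test_fun_abs:
  assumes "f \<in> test_fun J z"
  shows "(\<lambda>x. \<bar>f x\<bar>) \<in> test_fun J z"
  using assms
proof (rule test_funE)
  fix C r assume *: "continuous_on UNIV f" "0 \<le> C" "\<And>x. \<bar>f x\<bar> \<le> C"
    "\<And>x y. (\<And>t. t \<in> J \<Longrightarrow> x t = y t) \<Longrightarrow> f x = f y"
    "r > 0" "\<And>x. seq_dist J x (\<lambda>_. z) < r \<Longrightarrow> f x = 0"
  show ?thesis
  proof (rule test_funI[OF _ _ _ *(5)])
    show "continuous_on UNIV (\<lambda>x. \<bar>f x\<bar>)"
      by (intro continuous_intros *)
    show "\<bar>\<bar>f x\<bar>\<bar> \<le> C" for x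
      using *(3)[of x] by simp
    show "\<bar>f x\<bar> = \<bar>f y\<bar>" if "\<And>t. t \<in> J \<Longrightarrow> x t = y t" for x y
      using *(4)[OF that] by simp
  qed (use *(6) in auto)
qed

text \<open>For \<open>c > 0\<close> this is a ramp in the distance to the origin, equal to 0 up to
  distance \<open>1 / c\<close> and to 1 from distance \<open>2 / c\<close> on.\<close>

definition cutoff :: "int set \<Rightarrow> 'a::metric_space \<Rightarrow> real \<Rightarrow> (int \<Rightarrow> 'a) \<Rightarrow> real" where
  "cutoff J z c x = min 1 (max 0 (c * seq_dist J x (\<lambda>_. z) - 1))"

lemma cutoff_test_fun: "0 \<le> c \<Longrightarrow> cutoff J z c \<in> test_fun J z"
proof (rule test_funI[of _ 1 _ "1 / (c + 1)"])
  show "continuous_on UNIV (cutoff J z c)"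
    unfolding cutoff_def by (intro continuous_intros)
  show "\<bar>cutoff J z c x\<bar> \<le> 1" for x
    by (simp add: cutoff_def)
  show "cutoff J z c x = cutoff J z c y" if "\<And>t. t \<in> J \<Longrightarrow> x t = y t" for x y
    using seq_dist_cong[of J x y "\<lambda>_. z" "\<lambda>_. z"] that by (simp add: cutoff_def)
  \<comment> \<open>The radius \<open>1 / (c + 1)\<close> instead of \<open>1 / c\<close> also
    covers \<open>c = 0\<close>, where the cutoff is identically 0.\<close>
  show "0 \<le> c \<Longrightarrow> 0 < 1 / (c + 1)"
    by simp
  show "cutoff J z c x = 0" if "0 \<le> c" "seq_dist J x (\<lambda>_. z) < 1 / (c + 1)" for x
  proof -
    have "c * seq_dist J x (\<lambda>_. z) \<le> (c + 1) * seq_dist J x (\<lambda>_. z)"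
      by (intro mult_right_mono) auto
    also have "\<dots> < 1"
      using that by (simp add: field_simps)
    finally show ?thesis
      by (simp add: cutoff_def)
  qed
qed

lemma cutoff_eq_1: "0 < r \<Longrightarrow> r \<le> seq_dist J x (\<lambda>_. z) \<Longrightarrow> 2 / r \<le> c \<Longrightarrow> cutoff J z c x = 1"
proof -
  assume *: "0 < r" "r \<le> seq_dist J x (\<lambda>_. z)" "2 / r \<le> c"
  have "2 = 2 / r * r" using * by simp
  also have "\<dots> \<le> c * seq_dist J x (\<lambda>_. z)"
    using * by (intro mult_mono) (auto intro: order_trans[of 0 "2 / r"])
  finally show ?thesis
    by (simp add: cutoff_def)
qed

lemma cutoff_nonneg: "0 \<le> cutoff J z c x" and cutoff_le_1: "cutoff J z c x \<le> 1"
  by (auto simp: cutoff_def)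

lemma cutoff_mono: "J \<subseteq> K \<Longrightarrow> 0 \<le> c \<Longrightarrow> c \<le> d \<Longrightarrow> cutoff J z c x \<le> cutoff K z d x"
  unfolding cutoff_def
  by (intro min.mono max.mono diff_mono mult_mono seq_dist_mono) auto

subsection \<open>Convergence along test functions\<close>

text \<open>The mass of sequences vanishing on \<open>J\<close> is left arbitrary, as test functions on \<open>J\<close> do not see
  it. So a limit on \<open>K\<close> serves without modification as a limit on \<open>J \<subseteq> K\<close>.\<close>

definition finite_away :: "int set \<Rightarrow> 'a::metric_space \<Rightarrow> (int \<Rightarrow> 'a) measure \<Rightarrow> bool" where
  "finite_away J z \<kappa> \<longleftrightarrow> sets \<kappa> = sets borel \<and>
     (\<forall>r>0. emeasure \<kappa> {x. r \<le> seq_dist J x (\<lambda>_. z)} < \<infinity>)"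

definition seq_tendsto ::
    "int set \<Rightarrow> 'a::metric_space \<Rightarrow> ('i \<Rightarrow> (int \<Rightarrow> 'a) measure) \<Rightarrow> (int \<Rightarrow> 'a) measure \<Rightarrow> 'i filter \<Rightarrow> bool"
  where "seq_tendsto J z N \<kappa> F \<longleftrightarrow> finite_away J z \<kappa> \<and>
     (\<forall>f \<in> test_fun J z. ((\<lambda>u. \<integral>x. f x \<partial>N u) \<longlongrightarrow> (\<integral>x. f x \<partial>\<kappa>)) F)"

lemma seq_tendstoD:
  assumes "seq_tendsto J z N \<kappa> F"
  shows "finite_away J z \<kappa>"
    and "f \<in> test_fun J z \<Longrightarrow> ((\<lambda>u. \<integral>x. f x \<partial>N u) \<longlongrightarrow> (\<integral>x. f x \<partial>\<kappa>)) F"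
  using assms by (auto simp: seq_tendsto_def)

lemma measurable_test_fun: "f \<in> test_fun J z \<Longrightarrow> sets \<kappa> = sets borel \<Longrightarrow> f \<in> borel_measurable \<kappa>"
  by (auto simp: test_fun_def borel_measurable_continuous_onI cong: measurable_cong_sets)

lemma finite_away_mono:
  assumes "finite_away K z \<kappa>" "J \<subseteq> K"
  shows "finite_away J z \<kappa>"
  unfolding finite_away_def
proof (intro conjI allI impI)
  show s: "sets \<kappa> = sets borel"
    using assms by (simp add: finite_away_def)
  fix r :: real assume "r > 0"
  have "emeasure \<kappa> {x. r \<le> seq_dist J x (\<lambda>_. z)} \<le> emeasure \<kappa> {x. r \<le> seq_dist K x (\<lambda>_. z)}"
  proof (rule emeasure_mono)
    show "{x. r \<le> seq_dist K x (\<lambda>_. z)} \<in> sets \<kappa>"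
      unfolding s by measurable
  qed (use seq_dist_mono[OF assms(2), of _ "\<lambda>_. z"] in \<open>auto intro: order_trans\<close>)
  also have "\<dots> < \<infinity>"
    using assms \<open>r > 0\<close> by (simp add: finite_away_def)
  finally show "emeasure \<kappa> {x. r \<le> seq_dist J x (\<lambda>_. z)} < \<infinity>" .
qed

lemma seq_tendsto_mono: "seq_tendsto K z N \<kappa> F \<Longrightarrow> J \<subseteq> K \<Longrightarrow> seq_tendsto J z N \<kappa> F"
  unfolding seq_tendsto_def using finite_away_mono test_fun_mono by blast

text \<open>A test function is dominated by a constant times the indicator of the complement of a
  ball, which has finite mass even if \<open>\<kappa>\<close> is infinite.\<close>

lemma integrable_test_fun:
  assumes "finite_away J z \<kappa>" "f \<in> test_fun J z"
  shows "integrable \<kappa> f"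
  using assms(2)
proof (rule test_funE)
  fix C r assume *: "continuous_on UNIV f" "0 \<le> C" "\<And>x. \<bar>f x\<bar> \<le> C"
    "\<And>x y. (\<And>t. t \<in> J \<Longrightarrow> x t = y t) \<Longrightarrow> f x = f y"
    "r > 0" "\<And>x. seq_dist J x (\<lambda>_. z) < r \<Longrightarrow> f x = 0"
  let ?A = "{x. r \<le> seq_dist J x (\<lambda>_. z)}"
  have s: "sets \<kappa> = sets borel"
    using assms by (simp add: finite_away_def)
  have A: "?A \<in> sets \<kappa>"
    unfolding s by measurable
  have "emeasure \<kappa> ?A < \<infinity>"
    using assms *(5) by (simp add: finite_away_def)
  then have "integrable \<kappa> (\<lambda>x. C * indicator ?A x)"
    using A by (intro integrable_mult_right integrable_real_indicator)
  then show ?thesis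
  proof (rule Bochner_Integration.integrable_bound)
    show "f \<in> borel_measurable \<kappa>"
      using assms(2) s by (rule measurable_test_fun)
    show "AE x in \<kappa>. norm (f x) \<le> norm (C * indicator ?A x)"
      using *(2,3,6) by (auto simp: indicator_def abs_of_nonneg not_le intro!: AE_I2)
  qed
qed

lemma integrable_test_fun_finite:
  assumes "finite_measure N" "sets N = sets borel" "f \<in> test_fun J z"
  shows "integrable N f"
  using assms(3)
proof (rule test_funE)
  fix C r assume "\<And>x. \<bar>f x\<bar> \<le> C"
  then show ?thesis
    using measurable_test_fun[OF assms(3,2)]
    by (intro finite_measure.integrable_const_bound[OF assms(1), of _ C]) auto
qed

subsection \<open>From windows to all integers\<close>

text \<open>The approximation is the inf-convolution of \<open>h\<close> with \<open>k\<close> times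
  the distance over \<open>window k\<close>. It reads only window coordinates, is Lipschitz for that
  distance and stays between 0 and \<open>h\<close>. It converges because leaving a neighbourhood of
  \<open>x\<close> becomes ever more expensive.\<close>

lemma inf_convolution_approx:
  fixes h :: "(int \<Rightarrow> 'a::metric_space) \<Rightarrow> real"
  assumes h: "h \<in> test_fun UNIV z" and h_nonneg: "\<And>x. 0 \<le> h x"
  obtains H where "\<And>k. H k \<in> test_fun (window k) z" "\<And>k x. 0 \<le> H k x" "\<And>k x. H k x \<le> h x"
    "\<And>x. (\<lambda>k. H k x) \<longlonglongrightarrow> h x"
  using h
proof (rule test_funE)
  fix C r assume cont: "continuous_on UNIV h" and C: "0 \<le> C" "\<And>x. \<bar>h x\<bar> \<le> C"
    and r: "r > 0" "\<And>x. seq_dist UNIV x (\<lambda>_. z) < r \<Longrightarrow> h x = 0"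
  define D :: "nat \<Rightarrow> (int \<Rightarrow> 'a) \<Rightarrow> (int \<Rightarrow> 'a) \<Rightarrow> real" where "D k = seq_dist (window k)" for k
  define H where "H k x = (INF y. h y + real k * D k x y)" for k x
  have bdd: "bdd_below (range (\<lambda>y. h y + real k * D k x y))" for k x
    by (rule bdd_belowI[of _ 0]) (auto simp: D_def h_nonneg)
  have H_le: "H k x \<le> h y + real k * D k x y" for k x y
    unfolding H_def by (rule cINF_lower[OF bdd UNIV_I])
  have H_ge: "c \<le> H k x" if "\<And>y. c \<le> h y + real k * D k x y" for c k x
    unfolding H_def by (rule cINF_greatest) (use that in auto)
  have H_nonneg: "0 \<le> H k x" for k x
    by (rule H_ge) (auto simp: D_def h_nonneg)
  have H_le_h: "H k x \<le> h x" for k x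
    using H_le[of k x x] by (simp add: D_def)
  have lip: "H k x \<le> H k y + real k * D k x y" for k x y
  proof -
    have "H k x - real k * D k x y \<le> h w + real k * D k y w" for w
    proof -
      have "real k * D k x w \<le> real k * (D k x y + D k y w)"
        unfolding D_def by (intro mult_left_mono seq_dist_triangle) auto
      then show ?thesis
        using H_le[of k x w] by (simp add: algebra_simps)
    qed
    then have "H k x - real k * D k x y \<le> H k y"
      by (rule H_ge)
    then show ?thesis by simp
  qed
  have "H k \<in> test_fun (window k) z" for k
  proof (rule test_funI[of _ C _ r])
    show "continuous_on UNIV (H k)"
      unfolding continuous_on_def
    proof
      fix x
      have "continuous_on UNIV (\<lambda>y. real k * D k y x)"
        unfolding D_def by (intro continuous_intros)
      then have "((\<lambda>y. real k * D k y x) \<longlongrightarrow> real k * D k x x) (at x)"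
        by (auto simp: continuous_on_def)
      then have lim: "((\<lambda>y. real k * D k y x) \<longlongrightarrow> 0) (at x)"
        by (simp add: D_def)
      have le: "\<bar>H k y - H k x\<bar> \<le> real k * D k y x" for y
        using lip[of k y x] lip[of k x y] by (simp add: D_def seq_dist_commute[of _ x y] abs_le_iff)
      have "((\<lambda>y. H k y - H k x) \<longlongrightarrow> 0) (at x)"
        by (rule Lim_null_comparison[OF _ lim]) (use le in auto)
      then show "(H k \<longlongrightarrow> H k x) (at x within UNIV)"
        by (simp add: LIM_zero_iff)
    qed
    show "\<bar>H k x\<bar> \<le> C" for x
      using H_nonneg[of k x] H_le_h[of k x] C(2)[of x] by simp
    show "H k x = H k y" if "\<And>t. t \<in> window k \<Longrightarrow> x t = y t" for x y
    proof -
      have "D k x = D k y"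
        unfolding D_def by (intro ext seq_dist_cong) (auto simp: that)
      then show ?thesis by (simp add: H_def)
    qed
    show "H k x = 0" if "seq_dist (window k) x (\<lambda>_. z) < r" for x
    proof -
      \<comment> \<open>The competitor in the infimum: it agrees with \<open>x\<close> on the
        window, at cost 0, and sits at the origin elsewhere. Its full distance to the origin is then
        the window distance, so \<open>h y = 0\<close>.\<close>
      define y where "y t = (if t \<in> window k then x t else z)" for t
      have "seq_dist UNIV y (\<lambda>_. z) = seq_dist (window k) y (\<lambda>_. z)"
        using seq_dist_split[of "window k" UNIV y "\<lambda>_. z"] by (simp add: seq_dist_eq_0 y_def)
      also have "\<dots> = seq_dist (window k) x (\<lambda>_. z)"
        by (rule seq_dist_cong) (auto simp: y_def)
      finally have "h y = 0"
        using that by (intro r) simp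
      moreover have "D k x y = 0"
        by (simp add: D_def seq_dist_eq_0 y_def)
      ultimately show ?thesis
        using H_le[of k x y] H_nonneg[of k x] by simp
    qed
  qed (rule r)
  moreover have "(\<lambda>k. H k x) \<longlonglongrightarrow> h x" for x
  proof (rule LIMSEQ_I)
    fix e :: real assume "e > 0"
    define W where "W = h -` {h x - e / 2<..}"
    have "open W"
      unfolding W_def using cont by (intro open_vimage) auto
    moreover have "x \<in> W"
      using \<open>e > 0\<close> by (simp add: W_def)
    ultimately obtain \<delta> where \<delta>: "\<delta> > 0" "\<And>y. seq_dist UNIV x y < \<delta> \<Longrightarrow> y \<in> W"
      by (rule seq_dist_open) auto
    obtain m where m: "\<And>x y :: int \<Rightarrow> 'a. seq_dist UNIV x y \<le> seq_dist (window m) x y + \<delta> / 2"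
      using seq_dist_tail[of "\<delta> / 2"] \<delta> by auto
    \<comment> \<open>At window distance at least \<open>\<delta> / 2\<close> the penalty is at
      least \<open>C\<close>, a bound for \<open>h x\<close>. At smaller window distance the full
      distance is below \<open>\<delta>\<close> and \<open>y\<close> stays in
      \<open>W\<close>.\<close>
    obtain K where K: "C / (\<delta> / 2) \<le> real K"
      using real_arch_simple by blast
    have "norm (H k x - h x) < e" if "k \<ge> max m K" for k
    proof -
      have "h x - e / 2 \<le> H k x"
      proof (rule H_ge)
        fix y
        show "h x - e / 2 \<le> h y + real k * D k x y"
        proof (cases "D k x y < \<delta> / 2")
          case True
          have "seq_dist (window m) x y \<le> D k x y"
            unfolding D_def using that by (intro seq_dist_mono window_mono) auto
          then have "y \<in> W"
            using True m[of x y] by (intro \<delta>(2)) linarith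
          then have "h x - e / 2 < h y"
            by (simp add: W_def)
          moreover have "0 \<le> real k * D k x y"
            by (simp add: D_def)
          ultimately show ?thesis by linarith
        next
          case False
          have "C = C / (\<delta> / 2) * (\<delta> / 2)"
            using \<delta> by simp
          also have "\<dots> \<le> real k * D k x y"
            using False \<delta> K that by (intro mult_mono) auto
          finally show ?thesis
            using C(2)[of x] h_nonneg[of y] \<open>e > 0\<close> by simp
        qed
      qed
      then show ?thesis
        using H_le_h[of k x] \<open>e > 0\<close> by simp
    qed
    then show "\<exists>no. \<forall>n\<ge>no. norm (H n x - h x) < e"
      by blast
  qed
  ultimately show ?thesis
    using H_nonneg H_le_h that by blast
qed

text \<open>Some window test function below \<open>h\<close> loses less than \<open>e\<close> in its
  integral under \<open>\<kappa>\<close>. Its integrals under \<open>N u\<close> converge by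
  assumption and stay below those of \<open>h\<close>.\<close>

lemma seq_tendsto_UNIV_lower:
  fixes N :: "'i \<Rightarrow> (int \<Rightarrow> 'a::metric_space) measure"
  assumes fin: "finite_away UNIV z \<kappa>"
    and lim: "\<And>m. seq_tendsto (window m) z N \<kappa> F"
    and N: "\<forall>\<^sub>F u in F. finite_measure (N u) \<and> sets (N u) = sets borel"
    and h: "h \<in> test_fun UNIV z" "\<And>x. 0 \<le> h x" and "e > 0"
  shows "\<forall>\<^sub>F u in F. (\<integral>x. h x \<partial>\<kappa>) - e < (\<integral>x. h x \<partial>N u)"
proof -
  obtain H where H: "\<And>k. H k \<in> test_fun (window k) z" "\<And>k x. 0 \<le> H k x" "\<And>k x. H k x \<le> h x"
    "\<And>x. (\<lambda>k. H k x) \<longlonglongrightarrow> h x"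
    using inf_convolution_approx[OF h] by blast
  have s: "sets \<kappa> = sets borel"
    using fin by (simp add: finite_away_def)
  have "(\<lambda>k. \<integral>x. H k x \<partial>\<kappa>) \<longlonglongrightarrow> (\<integral>x. h x \<partial>\<kappa>)"
  proof (rule integral_dominated_convergence)
    show "integrable \<kappa> h"
      by (rule integrable_test_fun[OF fin h(1)])
    show "AE x in \<kappa>. norm (H k x) \<le> h x" for k
      using H(2,3) by auto
  qed (use H h s measurable_test_fun in blast)+
  then have "\<forall>\<^sub>F k in sequentially. (\<integral>x. h x \<partial>\<kappa>) - e < (\<integral>x. H k x \<partial>\<kappa>)"
    using \<open>e > 0\<close> by (intro order_tendstoD) auto
  then obtain k where "(\<integral>x. h x \<partial>\<kappa>) - e < (\<integral>x. H k x \<partial>\<kappa>)"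
    by (auto simp: eventually_sequentially)
  then have "\<forall>\<^sub>F u in F. (\<integral>x. h x \<partial>\<kappa>) - e < (\<integral>x. H k x \<partial>N u)"
    by (intro order_tendstoD(1)[OF seq_tendstoD(2)[OF lim H(1)]])
  with N show ?thesis
  proof eventually_elim
    case (elim u)
    have "(\<integral>x. H k x \<partial>N u) \<le> (\<integral>x. h x \<partial>N u)"
      using elim H h by (intro integral_mono integrable_test_fun_finite) auto
    with elim show ?case by linarith
  qed
qed

text \<open>A window test function \<open>g\<close> dominating \<open>f\<close> has convergent
  integrals. The lower bound applies to the nonnegative function \<open>g + f\<close>; subtracting
  the limit for \<open>g\<close> leaves the lower bound for \<open>f\<close>, and the same argument
  for \<open>- f\<close> gives the upper bound.\<close>

lemma seq_tendsto_UNIV: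
  fixes N :: "'i \<Rightarrow> (int \<Rightarrow> 'a::metric_space) measure"
  assumes fin: "finite_away UNIV z \<kappa>"
    and lim: "\<And>m. seq_tendsto (window m) z N \<kappa> F"
    and N: "\<forall>\<^sub>F u in F. finite_measure (N u) \<and> sets (N u) = sets borel"
  shows "seq_tendsto UNIV z N \<kappa> F"
  unfolding seq_tendsto_def
proof (intro conjI ballI fin)
  fix f assume f: "f \<in> test_fun UNIV z"
  then show "((\<lambda>u. \<integral>x. f x \<partial>N u) \<longlongrightarrow> (\<integral>x. f x \<partial>\<kappa>)) F"
  proof (rule test_funE)
    fix C r assume C: "0 \<le> C" "\<And>x. \<bar>f x\<bar> \<le> C"
      and r: "r > 0" "\<And>x. seq_dist UNIV x (\<lambda>_. z) < r \<Longrightarrow> f x = 0"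
    obtain m where m: "\<And>x y :: int \<Rightarrow> 'a. seq_dist UNIV x y \<le> seq_dist (window m) x y + r / 2"
      using seq_dist_tail[of "r / 2"] r by auto
    \<comment> \<open>The slope \<open>4 / r\<close> is \<open>2 / (r / 2)\<close>: where
      \<open>f\<close> is nonzero the full distance is at least \<open>r\<close>, so the window
      distance is at least \<open>r / 2\<close> and the cutoff equals 1.\<close>
    define g where "g x = C * cutoff (window m) z (4 / r) x" for x
    have gm: "g \<in> test_fun (window m) z"
      unfolding g_def using r by (intro test_fun_cmult cutoff_test_fun) auto
    then have g: "g \<in> test_fun UNIV z"
      by (rule test_fun_mono) simp
    have f_le: "\<bar>f x\<bar> \<le> g x" for x
    proof (cases "r \<le> seq_dist UNIV x (\<lambda>_. z)")
      case True
      then have "cutoff (window m) z (4 / r) x = 1"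
        using m[of x "\<lambda>_. z"] r by (intro cutoff_eq_1[of "r / 2"]) auto
      then show ?thesis using C by (simp add: g_def)
    next
      case False
      then show ?thesis using r(2)[of x] C by (simp add: g_def cutoff_nonneg)
    qed
    have lower: "\<forall>\<^sub>F u in F. (\<integral>x. f' x \<partial>\<kappa>) - e < (\<integral>x. f' x \<partial>N u)"
      if f': "f' \<in> test_fun UNIV z" "\<And>x. \<bar>f' x\<bar> \<le> g x" and e: "e > 0" for f' and e :: real
    proof -
      have "\<forall>\<^sub>F u in F. (\<integral>x. g x + f' x \<partial>\<kappa>) - e / 2 < (\<integral>x. g x + f' x \<partial>N u)"
      proof (rule seq_tendsto_UNIV_lower[OF fin lim N])
        show "0 \<le> g x + f' x" for x
          using f'(2)[of x] by linarith
      qed (use test_fun_add g f' e in auto)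
      moreover have "\<forall>\<^sub>F u in F. (\<integral>x. g x \<partial>N u) < (\<integral>x. g x \<partial>\<kappa>) + e / 2"
        using e by (intro order_tendstoD(2)[OF seq_tendstoD(2)[OF lim gm]]) auto
      ultimately show ?thesis
        using N
      proof eventually_elim
        case (elim u)
        then have "integrable (N u) g" "integrable (N u) f'"
          using g f' by (auto intro: integrable_test_fun_finite)
        moreover have "integrable \<kappa> g" "integrable \<kappa> f'"
          using g f' by (auto intro: integrable_test_fun[OF fin])
        ultimately show ?case
          using elim by simp
      qed
    qed
    show ?thesis
    proof (rule order_tendstoI)
      fix a assume "a < (\<integral>x. f x \<partial>\<kappa>)"
      then show "\<forall>\<^sub>F u in F. a < (\<integral>x. f x \<partial>N u)"
        using lower[OF f f_le, of "(\<integral>x. f x \<partial>\<kappa>) - a"] by simp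
    next
      fix a assume "(\<integral>x. f x \<partial>\<kappa>) < a"
      then show "\<forall>\<^sub>F u in F. (\<integral>x. f x \<partial>N u) < a"
        using lower[of "\<lambda>x. - f x" "a - (\<integral>x. f x \<partial>\<kappa>)"] test_fun_cmult[OF f, of "-1"] f_le by simp
    qed
  qed
qed

subsection \<open>Projective limits\<close>

text \<open>The indicator of a proper open set is the pointwise limit of ramps in the distance to
  its complement. So the measures agree on open sets, an intersection-stable generator of the Borel
  sets.\<close>

lemma finite_measure_eqI_continuous:
  fixes M N :: "'b::metric_space measure"
  assumes M: "finite_measure M" "sets M = sets borel"
    and N: "finite_measure N" "sets N = sets borel"
    and eq: "\<And>f :: 'b \<Rightarrow> real. continuous_on UNIV f \<Longrightarrow> (\<And>x. 0 \<le> f x) \<Longrightarrow> (\<And>x. f x \<le> 1) \<Longrightarrow>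
      (\<integral>x. f x \<partial>M) = (\<integral>x. f x \<partial>N)"
  shows "M = N"
proof -
  have lim: "(\<lambda>n. \<integral>x. min 1 (real n * infdist x (- U)) \<partial>L) \<longlonglongrightarrow> measure L U"
    if L: "finite_measure L" "sets L = sets borel" and U: "open U" "U \<noteq> UNIV"
    for L :: "'b measure" and U
  proof -
    have "(\<lambda>n. \<integral>x. min 1 (real n * infdist x (- U)) \<partial>L) \<longlonglongrightarrow> (\<integral>x. indicator U x \<partial>L)"
    proof (rule integral_dominated_convergence[where w = "\<lambda>_. 1"])
      show "(indicator U :: 'b \<Rightarrow> real) \<in> borel_measurable L"
        using U L by (auto cong: measurable_cong_sets)
      show "(\<lambda>x. min 1 (real n * infdist x (- U))) \<in> borel_measurable L" for n
        unfolding measurable_cong_sets[OF L(2) refl]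
        by (intro borel_measurable_continuous_onI continuous_intros)
      show "integrable L (\<lambda>_. 1 :: real)"
        using L(1) by (rule finite_measure.integrable_const)
      show "AE x in L. norm (min 1 (real n * infdist x (- U))) \<le> 1" for n
        by (simp add: infdist_nonneg abs_of_nonneg)
      have "(\<lambda>n. min 1 (real n * infdist x (- U))) \<longlonglongrightarrow> indicator U x" for x
      proof (cases "x \<in> U")
        case True
        then have pos: "infdist x (- U) > 0"
          using U infdist_pos_not_in_closed[of "- U" x] by auto
        obtain K where K: "1 / infdist x (- U) \<le> real K"
          using real_arch_simple by blast
        have "min 1 (real n * infdist x (- U)) = indicator U x" if "n \<ge> K" for n
        proof -
          have "1 = 1 / infdist x (- U) * infdist x (- U)"
            using pos by simp
          also have "\<dots> \<le> real n * infdist x (- U)"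
            using K that pos by (intro mult_right_mono) auto
          finally show ?thesis using True by simp
        qed
        then show ?thesis
          by (intro tendsto_eventually) (auto simp: eventually_sequentially)
      qed simp
      then show "AE x in L. (\<lambda>n. min 1 (real n * infdist x (- U))) \<longlonglongrightarrow> indicator U x"
        by simp
    qed
    moreover have "U \<inter> space L = U"
      using sets_eq_imp_space_eq[OF L(2)] by simp
    ultimately show ?thesis
      by simp
  qed
  have open_eq: "measure M U = measure N U" if "open U" for U
  \<comment> \<open>The whole space is handled by the constant 1: \<open>infdist\<close> to the
    empty set is 0, so the ramps would vanish there.\<close>
  proof (cases "U = UNIV")
    case True
    then show ?thesis
      using eq[of "\<lambda>_. 1"] sets_eq_imp_space_eq[OF M(2)] sets_eq_imp_space_eq[OF N(2)] by simp
  next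
    case False
    have "(\<integral>x. min 1 (real n * infdist x (- U)) \<partial>M) = (\<integral>x. min 1 (real n * infdist x (- U)) \<partial>N)" for n
      by (intro eq continuous_intros) (auto simp: infdist_nonneg)
    then show ?thesis
      using lim[OF M that False] lim[OF N that False] LIMSEQ_unique by simp
  qed
  show ?thesis
  proof (rule measure_eqI_generator_eq[where E = "{S. open S}" and \<Omega> = UNIV and A = "\<lambda>_. UNIV"])
    show "emeasure M X = emeasure N X" if "X \<in> {S. open S}" for X
      using open_eq[of X] that M N by (simp add: finite_measure.emeasure_eq_measure)
    show "sets M = sigma_sets UNIV {S. open S}" "sets N = sigma_sets UNIV {S. open S}"
      using M(2) N(2) by (auto simp: borel_def)
    show "emeasure M UNIV \<noteq> \<infinity>"
      using M by (simp add: finite_measure.emeasure_eq_measure)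
  qed (auto simp: Int_stable_def)
qed

text \<open>A right inverse of restriction to \<open>J\<close>, which embeds the product over
  \<open>J\<close> into the total functions. With \<open>z\<close> the origin of the state space it
  sends origin to origin.\<close>

definition fill :: "int set \<Rightarrow> 'a \<Rightarrow> (int \<Rightarrow> 'a) \<Rightarrow> int \<Rightarrow> 'a" where
  "fill J z x = (\<lambda>t. if t \<in> J then x t else z)"

lemma continuous_on_fill: "continuous_on UNIV (fill J z :: (int \<Rightarrow> 'a::topological_space) \<Rightarrow> _)"
proof (rule continuous_on_coordinatewise_then_product)
  fix t
  show "continuous_on UNIV (\<lambda>x :: int \<Rightarrow> 'a. fill J z x t)"
    by (cases "t \<in> J") (auto simp: fill_def intro: continuous_on_product_coordinates)
qed

section \<open>Borel sets of the sequence space and cylinder functions\<close>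

lemma sets_borel_fun:
  "sets (borel :: (int \<Rightarrow> 'a::second_countable_topology) measure) = sets (PiM UNIV (\<lambda>_. borel))"
  using sets_PiM_equal_borel by blast

lemma measurable_restrict_borel:
  "(\<lambda>x. restrict x J) \<in> (borel :: (int \<Rightarrow> 'a::second_countable_topology) measure) \<rightarrow>\<^sub>M PiM J (\<lambda>_. borel)"
  unfolding measurable_cong_sets[OF sets_borel_fun refl] by (rule measurable_restrict_subset) simp

lemma measurable_into_borel_fun:
  fixes g :: "'w \<Rightarrow> int \<Rightarrow> 'a::second_countable_topology"
  assumes "\<And>t. (\<lambda>w. g w t) \<in> M \<rightarrow>\<^sub>M borel"
  shows "g \<in> M \<rightarrow>\<^sub>M borel"
  unfolding measurable_cong_sets[OF refl sets_borel_fun]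
  by (rule measurable_PiM_single') (use assms in auto)

lemma measurable_fill:
  "fill J z \<in> PiM J (\<lambda>_. borel) \<rightarrow>\<^sub>M (borel :: (int \<Rightarrow> 'a::second_countable_topology) measure)"
proof (rule measurable_into_borel_fun)
  fix t
  show "(\<lambda>w. fill J z w t) \<in> PiM J (\<lambda>_. borel) \<rightarrow>\<^sub>M borel"
    unfolding fill_def by (cases "t \<in> J") auto
qed

lemma fill_restrict:
  assumes "\<And>x y. (\<And>t. t \<in> J \<Longrightarrow> x t = y t) \<Longrightarrow> f x = f y"
  shows "f (fill J z (restrict x J)) = f x"
  by (rule assms) (simp add: fill_def)

text \<open>Agreement on continuous cylinder functions with values in \<open>[0, 1]\<close> already
  gives agreement of the window marginals. Kolmogorov's theorem applies once every finite index set
  inherits its law from a window containing it.\<close>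

lemma projective_limit_windows:
  fixes R :: "nat \<Rightarrow> (int \<Rightarrow> 'a::polish_space) measure"
  assumes prob: "\<And>m. prob_space (R m)" and sets_R: "\<And>m. sets (R m) = sets borel"
    and cons: "\<And>m k f. m \<le> k \<Longrightarrow> continuous_on UNIV f \<Longrightarrow> (\<And>x. 0 \<le> f x) \<Longrightarrow> (\<And>x. f x \<le> (1::real)) \<Longrightarrow>
      (\<And>x y. (\<And>t. t \<in> window m \<Longrightarrow> x t = y t) \<Longrightarrow> f x = f y) \<Longrightarrow>
      (\<integral>x. f x \<partial>R k) = (\<integral>x. f x \<partial>R m)"
  obtains Q where "prob_space Q" "sets Q = sets borel"
    "\<And>m f. f \<in> borel_measurable borel \<Longrightarrow> (\<And>x y. (\<And>t. t \<in> window m \<Longrightarrow> x t = y t) \<Longrightarrow> f x = (f y :: real)) \<Longrightarrow>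
      (\<integral>x. f x \<partial>Q) = (\<integral>x. f x \<partial>R m)"
proof -
  let ?B = "\<lambda>J. PiM J (\<lambda>_. borel :: 'a measure)"
  let ?res = "\<lambda>J (x :: int \<Rightarrow> 'a). restrict x J"
  \<comment> \<open>An arbitrary filler; the functions and sets considered below never read the
    filled coordinates.\<close>
  fix z :: 'a
  have R_cong: "measurable (R m) M = measurable borel M" for m and M :: "'c measure"
    by (rule measurable_cong_sets[OF sets_R refl])
  have res[measurable]: "?res J \<in> borel \<rightarrow>\<^sub>M ?B J" for J
    by (rule measurable_restrict_borel)
  have fill: "fill J z \<in> borel \<rightarrow>\<^sub>M borel" for J
    by (intro borel_measurable_continuous_onI continuous_on_fill)
  have eq: "distr (R k) (?B J) (?res J) = distr (R m) (?B J) (?res J)"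
    if "m \<le> k" "J \<subseteq> window m" for m k J
  proof -
    \<comment> \<open>Filling up outside the window keeps the laws on a metric type, where
      continuous functions determine them. Restriction to \<open>J\<close> follows afterwards and
      undoes the filling.\<close>
    let ?p = "fill (window m) z"
    have "distr (R k) borel ?p = distr (R m) borel ?p"
    proof (rule finite_measure_eqI_continuous)
      show "finite_measure (distr (R k) borel ?p)" "finite_measure (distr (R m) borel ?p)"
        using prob fill by (auto simp: R_cong intro!: prob_space.finite_measure prob_space.prob_space_distr)
      fix f :: "(int \<Rightarrow> 'a) \<Rightarrow> real" assume f: "continuous_on UNIV f" "\<And>x. 0 \<le> f x" "\<And>x. f x \<le> 1"
      have "(\<integral>x. f (?p x) \<partial>R k) = (\<integral>x. f (?p x) \<partial>R m)"
      proof (rule cons[OF that(1)])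
        show "continuous_on UNIV (\<lambda>x. f (?p x))"
          by (rule continuous_on_compose2[OF f(1) continuous_on_fill]) simp
        show "f (?p x) = f (?p y)" if "\<And>t. t \<in> window m \<Longrightarrow> x t = y t" for x y
          using that by (auto simp: fill_def intro!: arg_cong[of _ _ f])
      qed (use f in auto)
      then show "(\<integral>x. f x \<partial>distr (R k) borel ?p) = (\<integral>x. f x \<partial>distr (R m) borel ?p)"
        by (subst (1 2) integral_distr)
          (simp_all only: R_cong fill borel_measurable_continuous_onI[OF f(1)])
    qed simp_all
    then have "distr (distr (R k) borel ?p) (?B J) (?res J) = distr (distr (R m) borel ?p) (?B J) (?res J)"
      by simp
    moreover have "?res J \<circ> ?p = ?res J"
      using that by (auto simp: fill_def fun_eq_iff)
    ultimately show ?thesis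
      by (simp add: distr_distr R_cong fill)
  qed
  have "\<exists>m. finite J \<longrightarrow> J \<subseteq> window m" for J
    using finite_subset_window by blast
  then obtain w where w: "\<And>J. finite J \<Longrightarrow> J \<subseteq> window (w J)"
    by metis
  define P where "P J = distr (R (w J)) (?B J) (?res J)" for J
  \<comment> \<open>The law does not depend on the window chosen for \<open>J\<close>: both windows
    are compared with the larger one.\<close>
  have P_eq: "P J = distr (R m) (?B J) (?res J)" if "finite J" "J \<subseteq> window m" for J m
    using eq[of m "max m (w J)" J] eq[of "w J" "max m (w J)" J] w that by (simp add: P_def)
  interpret PP: polish_projective UNIV P
  proof (intro polish_projective.intro projective_family.intro)
    fix J H :: "int set" assume *: "J \<subseteq> H" "finite H" "H \<subseteq> UNIV"
    have "distr (P H) (?B J) (?res J) = distr (R (w H)) (?B J) (?res J \<circ> ?res H)"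
      unfolding P_def by (subst distr_distr) (auto simp: R_cong measurable_restrict_subset *)
    also have "?res J \<circ> ?res H = ?res J"
      using * by (auto simp: fun_eq_iff restrict_def)
    also have "distr (R (w H)) (?B J) (?res J) = P J"
      using w[of H] * by (intro P_eq[symmetric]) (auto intro: finite_subset)
    finally show "P J = distr (P H) (?B J) (?res J)" ..
  next
    fix J :: "int set" assume "finite J" "J \<subseteq> UNIV"
    show "prob_space (P J)"
      unfolding P_def by (rule prob_space.prob_space_distr[OF prob]) (simp add: R_cong)
  qed
  have sets_lim: "sets PP.lim = sets borel"
    by (simp add: sets_borel_fun)
  have lim_cong: "measurable PP.lim M = measurable borel M" for M :: "'c measure"
    by (rule measurable_cong_sets[OF sets_lim refl])
  have distr_lim: "distr PP.lim (?B J) (?res J) = P J" if "finite J" for J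
  proof (rule measure_eqI)
    fix A assume "A \<in> sets (distr PP.lim (?B J) (?res J))"
    then have A: "A \<in> sets (?B J)" by simp
    then have "emeasure (distr PP.lim (?B J) (?res J)) A = emeasure PP.lim (?res J -` A \<inter> space PP.lim)"
      by (intro emeasure_distr) (simp_all add: lim_cong)
    \<comment> \<open>Preimages under restriction are the cylinder sets on which the projective
      limit is specified.\<close>
    also have "?res J -` A \<inter> space PP.lim = prod_emb UNIV (\<lambda>_. borel) J A"
      by (simp add: prod_emb_def space_PiM)
    also have "emeasure PP.lim \<dots> = emeasure (P J) A"
      using that A by (intro PP.emeasure_lim_emb) auto
    finally show "emeasure (distr PP.lim (?B J) (?res J)) A = emeasure (P J) A" .
  qed (simp add: P_def)
  show ?thesis
  proof (rule that[OF PP.P.prob_space_axioms sets_lim])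
    fix m and f :: "(int \<Rightarrow> 'a) \<Rightarrow> real"
    assume f: "f \<in> borel_measurable borel" "\<And>x y. (\<And>t. t \<in> window m \<Longrightarrow> x t = y t) \<Longrightarrow> f x = f y"
    let ?J = "window m"
    have int: "(\<integral>x. f x \<partial>L) = (\<integral>x. f (fill ?J z x) \<partial>distr L (?B ?J) (?res ?J))"
      if "sets L = sets borel" for L
    proof -
      have "(\<integral>x. f (fill ?J z x) \<partial>distr L (?B ?J) (?res ?J)) = (\<integral>x. f (fill ?J z (restrict x ?J)) \<partial>L)"
        using measurable_compose[OF measurable_fill f(1)] res
        by (intro integral_distr) (auto simp: measurable_cong_sets[OF that refl])
      then show ?thesis
        using fill_restrict[of ?J f z, OF f(2)] by simp
    qed
    show "(\<integral>x. f x \<partial>PP.lim) = (\<integral>x. f x \<partial>R m)"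
      using int[OF sets_lim] int[OF sets_R] distr_lim P_eq[of ?J m] by simp
  qed
qed

text \<open>Normalized, \<open>g\<close> is a density that turns the window limits into probability
  measures. They stay consistent because \<open>g\<close> times a bounded continuous cylinder
  function is again a test function.\<close>

lemma projective_limit_weighted:
  fixes \<kappa> :: "nat \<Rightarrow> (int \<Rightarrow> 'a::polish_space) measure"
  assumes fin: "\<And>m. finite_away (window m) z (\<kappa> m)"
    and cons: "\<And>m k f. m \<le> k \<Longrightarrow> f \<in> test_fun (window m) z \<Longrightarrow> (\<integral>x. f x \<partial>\<kappa> k) = (\<integral>x. f x \<partial>\<kappa> m)"
    and g: "g \<in> test_fun (window n) z" "\<And>x. 0 \<le> g x"
  obtains Q where "prob_space Q" "sets Q = sets borel"
    "\<And>m f. n \<le> m \<Longrightarrow> f \<in> test_fun (window m) z \<Longrightarrow>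
      (\<integral>x. g x \<partial>\<kappa> n) * (\<integral>x. f x \<partial>Q) = (\<integral>x. g x * f x \<partial>\<kappa> m)"
proof -
  define c where "c = (\<integral>x. g x \<partial>\<kappa> n)"
  have sets_\<kappa>: "sets (\<kappa> m) = sets borel" for m
    using fin by (simp add: finite_away_def)
  have g_int: "integrable (\<kappa> m) g" if "n \<le> m" for m
    using that by (intro integrable_test_fun[OF fin] test_fun_mono[OF g(1)] window_mono)
  have c: "(\<integral>x. g x \<partial>\<kappa> m) = c" if "n \<le> m" for m
    unfolding c_def by (rule cons[OF that g(1)])
  show ?thesis
  proof (cases "c = 0")
    case True
    \<comment> \<open>With total weight 0, \<open>g\<close> vanishes almost everywhere under all the
      measures concerned, and both sides are 0 whatever \<open>Q\<close> is; a point mass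
      serves.\<close>
    show ?thesis
    proof (rule that[of "return borel (\<lambda>_. z)"])
      fix m f assume m: "n \<le> m" and "f \<in> test_fun (window m) z"
      have "AE x in \<kappa> m. g x = 0"
        using integral_nonneg_eq_0_iff_AE[OF g_int[OF m]] g(2) c[OF m] True by simp
      then have "AE x in \<kappa> m. g x * f x = 0"
        by eventually_elim simp
      then have "(\<integral>x. g x * f x \<partial>\<kappa> m) = 0"
        by (rule integral_eq_zero_AE)
      then show "(\<integral>x. g x \<partial>\<kappa> n) * (\<integral>x. f x \<partial>return borel (\<lambda>_. z)) = (\<integral>x. g x * f x \<partial>\<kappa> m)"
        using True by (simp add: c_def)
    qed (auto intro: prob_space_return)
  next
    case False
    moreover have "0 \<le> c"
      unfolding c_def using g by simp
    ultimately have "0 < c" by simp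
    \<comment> \<open>The weight \<open>g\<close> reads \<open>window n\<close>, so indices below
      \<open>n\<close> reuse the weighted measure at \<open>n\<close>.\<close>
    define R where "R m = density (\<kappa> (max m n)) (\<lambda>x. ennreal (g x / c))" for m
    have g_meas: "g \<in> borel_measurable (\<kappa> m)" for m
      by (rule measurable_test_fun[OF g(1) sets_\<kappa>])
    have int_R: "(\<integral>x. f x \<partial>R m) = (\<integral>x. g x * f x \<partial>\<kappa> (max m n)) / c"
      if "f \<in> borel_measurable borel" for m and f :: "_ \<Rightarrow> real"
    proof -
      have "(\<integral>x. f x \<partial>R m) = (\<integral>x. g x / c * f x \<partial>\<kappa> (max m n))"
        unfolding R_def using that g(2) g_meas \<open>0 < c\<close>
        by (intro integral_real_density) (auto simp: measurable_cong_sets[OF sets_\<kappa> refl])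
      also have "(\<lambda>x. g x / c * f x) = (\<lambda>x. g x * f x / c)"
        by simp
      finally show ?thesis by simp
    qed
    obtain Q where Q: "prob_space Q" "sets Q = sets borel"
      and int_Q: "\<And>m f. f \<in> borel_measurable borel \<Longrightarrow> (\<And>x y. (\<And>t. t \<in> window m \<Longrightarrow> x t = y t) \<Longrightarrow> f x = (f y :: real)) \<Longrightarrow>
        (\<integral>x. f x \<partial>Q) = (\<integral>x. f x \<partial>R m)"
    proof (rule projective_limit_windows[of R])
      fix m
      show "sets (R m) = sets borel"
        by (simp add: R_def sets_\<kappa>)
      have "emeasure (R m) (space (R m)) = (\<integral>\<^sup>+x. ennreal (g x / c) \<partial>\<kappa> (max m n))"
        unfolding R_def using g_meas by (subst emeasure_density) (auto intro!: nn_integral_cong)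
      also have "\<dots> = ennreal (\<integral>x. g x / c \<partial>\<kappa> (max m n))"
        using g g_int \<open>0 < c\<close> by (intro nn_integral_eq_integral) auto
      also have "\<dots> = 1"
        using c[of "max m n"] \<open>0 < c\<close> by simp
      finally show "prob_space (R m)"
        by (rule prob_spaceI)
    next
      fix m k :: nat and f :: "(int \<Rightarrow> 'a) \<Rightarrow> real"
      assume "m \<le> k" and f: "continuous_on UNIV f" "\<And>x. 0 \<le> f x" "\<And>x. f x \<le> 1"
        "\<And>x y. (\<And>t. t \<in> window m \<Longrightarrow> x t = y t) \<Longrightarrow> f x = f y"
      have w: "window m \<subseteq> window (max m n)" "window n \<subseteq> window (max m n)"
        by (auto intro!: window_mono)
      have "(\<lambda>x. g x * f x) \<in> test_fun (window (max m n)) z"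
      proof (rule test_fun_mult[OF test_fun_mono[OF g(1) w(2)] f(1)])
        show "\<bar>f x\<bar> \<le> 1" for x
          using f(2,3)[of x] by simp
        show "f x = f y" if "\<And>t. t \<in> window (max m n) \<Longrightarrow> x t = y t" for x y
          using that w by (intro f(4)) auto
      qed
      then have "(\<integral>x. g x * f x \<partial>\<kappa> (max k n)) = (\<integral>x. g x * f x \<partial>\<kappa> (max m n))"
        using \<open>m \<le> k\<close> by (intro cons) auto
      then show "(\<integral>x. f x \<partial>R k) = (\<integral>x. f x \<partial>R m)"
        using int_R borel_measurable_continuous_onI[OF f(1)] by simp
    qed (use that in blast)
    show ?thesis
    proof (rule that[OF Q])
      fix m f assume m: "n \<le> m" and f: "f \<in> test_fun (window m) z"
      have f_meas: "f \<in> borel_measurable borel"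
        by (rule measurable_test_fun[OF f refl])
      have "(\<integral>x. f x \<partial>Q) = (\<integral>x. f x \<partial>R m)"
        using f by (intro int_Q[OF f_meas]) (auto simp: test_fun_def)
      then show "(\<integral>x. g x \<partial>\<kappa> n) * (\<integral>x. f x \<partial>Q) = (\<integral>x. g x * f x \<partial>\<kappa> m)"
        using int_R[OF f_meas, of m] m \<open>0 < c\<close> by (simp add: c_def max_absorb1)
    qed
  qed
qed

text \<open>Limits over different index sets may differ as measures; they are compared on the test
  functions common to both.\<close>

lemma seq_tendsto_unique:
  assumes "seq_tendsto J z N \<kappa> F" "seq_tendsto K z N \<kappa>' F" "f \<in> test_fun J z" "f \<in> test_fun K z"
    and "F \<noteq> bot"
  shows "(\<integral>x. f x \<partial>\<kappa>) = (\<integral>x. f x \<partial>\<kappa>')"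
  by (rule tendsto_unique[OF assms(5) seq_tendstoD(2)[OF assms(1,3)] seq_tendstoD(2)[OF assms(2,4)]])

text \<open>The differences \<open>g n\<close> of successive cutoffs form a partition of unity off
  the origin, and each of them cuts the limits down to finite measures with a common extension.
  Against a fixed window test function only finitely many pieces contribute, so their sum reproduces
  its integral.\<close>

lemma projective_limit_test_fun:
  fixes \<kappa> :: "nat \<Rightarrow> (int \<Rightarrow> 'a::polish_space) measure"
  assumes fin: "\<And>m. finite_away (window m) z (\<kappa> m)"
    and cons: "\<And>m k f. m \<le> k \<Longrightarrow> f \<in> test_fun (window m) z \<Longrightarrow> (\<integral>x. f x \<partial>\<kappa> k) = (\<integral>x. f x \<partial>\<kappa> m)"
  obtains \<kappa>' where "finite_away UNIV z \<kappa>'"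
    "\<And>m f. f \<in> test_fun (window m) z \<Longrightarrow> (\<integral>x. f x \<partial>\<kappa>') = (\<integral>x. f x \<partial>\<kappa> m)"
proof -
  \<comment> \<open>Window and slope grow together. As \<open>h 0\<close> has slope 0 it is
    identically 0, which makes the telescoping sum start at 0.\<close>
  define h where "h n = cutoff (window n) z (real n)" for n
  define g where "g n x = h (Suc n) x - h n x" for n x
  \<comment> \<open>The index is \<open>Suc n\<close> because \<open>g n\<close> contains
    \<open>h (Suc n)\<close> and reads \<open>window (Suc n)\<close>.\<close>
  define c where "c n = (\<integral>x. g n x \<partial>\<kappa> (Suc n))" for n
  have h: "h n \<in> test_fun (window n) z" for n
    unfolding h_def by (rule cutoff_test_fun) simp
  have g: "g n \<in> test_fun (window (Suc n)) z" for n
    unfolding g_def using h test_fun_mono[OF h[of n] window_mono[of n "Suc n"]]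
    by (intro test_fun_diff) auto
  have h_mono: "h m x \<le> h n x" if "m \<le> n" for m n x
    unfolding h_def using that by (intro cutoff_mono window_mono) auto
  have g_nonneg: "0 \<le> g n x" for n x
    using h_mono[of n "Suc n" x] by (simp add: g_def)
  have "\<exists>Q. prob_space Q \<and> sets Q = sets borel \<and> (\<forall>m f. Suc n \<le> m \<longrightarrow> f \<in> test_fun (window m) z \<longrightarrow>
      c n * (\<integral>x. f x \<partial>Q) = (\<integral>x. g n x * f x \<partial>\<kappa> m))" for n
    unfolding c_def by (rule projective_limit_weighted[OF fin cons g g_nonneg]) blast+
  then obtain Q where Q: "\<And>n. prob_space (Q n)" "\<And>n. sets (Q n) = sets borel"
    and int_Q: "\<And>n m f. Suc n \<le> m \<Longrightarrow> f \<in> test_fun (window m) z \<Longrightarrow>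
      c n * (\<integral>x. f x \<partial>Q n) = (\<integral>x. g n x * f x \<partial>\<kappa> m)"
    by metis
  have c_nonneg: "0 \<le> c n" for n
    unfolding c_def using g_nonneg by simp
  \<comment> \<open>This is the countable sum of the measures \<open>Q n\<close> with weights
    \<open>c n\<close>, written as a mixture over a discrete measure.\<close>
  define \<kappa>' where "\<kappa>' = bind (density (count_space UNIV) (\<lambda>n. ennreal (c n))) Q"
  have Q_meas: "Q \<in> density (count_space UNIV) (\<lambda>n. ennreal (c n)) \<rightarrow>\<^sub>M subprob_algebra borel"
    using Q by (auto simp: space_subprob_algebra intro: prob_space_imp_subprob_space)
  have sets_\<kappa>': "sets \<kappa>' = sets borel"
    unfolding \<kappa>'_def using Q by (intro sets_bind) auto
  have nn_\<kappa>': "(\<integral>\<^sup>+x. f x \<partial>\<kappa>') = (\<Sum>n. ennreal (c n) * (\<integral>\<^sup>+x. f x \<partial>Q n))"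
    if "f \<in> borel_measurable borel" for f
    unfolding \<kappa>'_def
    by (simp add: nn_integral_bind[OF that Q_meas] nn_integral_density nn_integral_count_space_nat)
  have pos: "(\<integral>\<^sup>+x. ennreal (f x) \<partial>\<kappa>') = ennreal (\<integral>x. f x \<partial>\<kappa> m)"
    if f: "f \<in> test_fun (window m) z" "\<And>x. 0 \<le> f x" for f m
    using f(1)
  proof (rule test_funE)
    fix r assume r: "r > 0" "\<And>x. seq_dist (window m) x (\<lambda>_. z) < r \<Longrightarrow> f x = 0"
    obtain K where K: "2 / r \<le> real K"
      using real_arch_simple by blast
    \<comment> \<open>From \<open>M\<close> on the window contains \<open>window m\<close> and the
      slope is at least \<open>2 / r\<close>, so \<open>h n\<close> is 1 wherever \<open>f\<close>
      is nonzero and \<open>g n\<close> times \<open>f\<close> is 0.\<close>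
    define M where "M = max m K"
    have f_h: "h n x * f x = f x" if "M \<le> n" for n x
    proof (cases "seq_dist (window m) x (\<lambda>_. z) < r")
      case False
      then have "r \<le> seq_dist (window n) x (\<lambda>_. z)"
        using seq_dist_mono[OF window_mono[of m n], of x "\<lambda>_. z"] that by (auto simp: M_def)
      then have "h n x = 1"
        unfolding h_def using r K that by (intro cutoff_eq_1[of r]) (auto simp: M_def)
      then show ?thesis by simp
    qed (simp add: r)
    have fk: "f \<in> test_fun (window k) z" if "m \<le> k" for k
      using that by (intro test_fun_mono[OF f(1)] window_mono)
    have c_int: "c n * (\<integral>x. f x \<partial>Q n) = (\<integral>x. g n x * f x \<partial>\<kappa> k)" if "m \<le> k" "Suc n \<le> k" for n k
      using that fk by (intro int_Q) auto
    have "ennreal (c n) * (\<integral>\<^sup>+x. ennreal (f x) \<partial>Q n) = ennreal (c n * (\<integral>x. f x \<partial>Q n))" for n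
    proof -
      have "integrable (Q n) f"
        by (rule integrable_test_fun_finite[OF prob_space.finite_measure[OF Q(1)] Q(2) f(1)])
      then show ?thesis
        using f(2) c_nonneg by (simp add: nn_integral_eq_integral ennreal_mult')
    qed
    then have "(\<integral>\<^sup>+x. ennreal (f x) \<partial>\<kappa>') = (\<Sum>n. ennreal (c n * (\<integral>x. f x \<partial>Q n)))"
      using measurable_test_fun[OF f(1) refl] by (subst nn_\<kappa>') auto
    also have "\<dots> = (\<Sum>n<M. ennreal (c n * (\<integral>x. f x \<partial>Q n)))"
    proof (rule suminf_finite)
      fix n assume "n \<notin> {..<M}"
      then have "g n x * f x = 0" for x
        using f_h[of n x] f_h[of "Suc n" x] by (auto simp: g_def)
      then have "(\<lambda>x. g n x * f x) = (\<lambda>_. 0)"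
        by blast
      then show "ennreal (c n * (\<integral>x. f x \<partial>Q n)) = 0"
        using c_int[of "max m (Suc n)" n] by auto
    qed simp
    also have "\<dots> = ennreal (\<Sum>n<M. c n * (\<integral>x. f x \<partial>Q n))"
      using f c_nonneg by (intro sum_ennreal) simp
    also have "(\<Sum>n<M. c n * (\<integral>x. f x \<partial>Q n)) = (\<Sum>n<M. \<integral>x. g n x * f x \<partial>\<kappa> M)"
      by (intro sum.cong refl c_int) (auto simp: M_def)
    also have "\<dots> = (\<integral>x. (\<Sum>n<M. g n x * f x) \<partial>\<kappa> M)"
    proof (rule Bochner_Integration.integral_sum[symmetric])
      fix n assume "n \<in> {..<M}"
      from f(1) show "integrable (\<kappa> M) (\<lambda>x. g n x * f x)"
      proof (rule test_funE)
        fix B assume B: "continuous_on UNIV f" "\<And>x. \<bar>f x\<bar> \<le> B"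
          "\<And>x y. (\<And>t. t \<in> window m \<Longrightarrow> x t = y t) \<Longrightarrow> f x = f y"
        have w: "window m \<subseteq> window M" "window (Suc n) \<subseteq> window M"
          using \<open>n \<in> {..<M}\<close> by (auto intro!: window_mono simp: M_def)
        have "(\<lambda>x. g n x * f x) \<in> test_fun (window M) z"
        proof (rule test_fun_mult[OF test_fun_mono[OF g w(2)] B(1,2)])
          show "f x = f y" if "\<And>t. t \<in> window M \<Longrightarrow> x t = y t" for x y
            using w(1) by (intro B(3) that) auto
        qed
        then show ?thesis
          by (rule integrable_test_fun[OF fin])
      qed
    qed
    also have "(\<lambda>x. \<Sum>n<M. g n x * f x) = f"
    proof
      fix x
      have "(\<Sum>n<M. g n x) = h M x - h 0 x"
        unfolding g_def by (rule sum_lessThan_telescope)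
      then show "(\<Sum>n<M. g n x * f x) = f x"
        using f_h[of M x] by (simp add: sum_distrib_right[symmetric] h_def[of 0] cutoff_def)
    qed
    also have "(\<integral>x. f x \<partial>\<kappa> M) = (\<integral>x. f x \<partial>\<kappa> m)"
      by (rule cons[OF _ f(1)]) (simp add: M_def)
    finally show ?thesis .
  qed
  have fin': "finite_away UNIV z \<kappa>'"
    unfolding finite_away_def
  proof (intro conjI allI impI sets_\<kappa>')
    fix r :: real assume "r > 0"
    obtain m where m: "\<And>x y :: int \<Rightarrow> 'a. seq_dist UNIV x y \<le> seq_dist (window m) x y + r / 2"
      using seq_dist_tail[of "r / 2"] \<open>r > 0\<close> by auto
    \<comment> \<open>Distance at least \<open>r\<close> over all integers leaves at least
      \<open>r / 2\<close> over the window, where a cutoff of slope \<open>2 / (r / 2)\<close> is 1.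
      So its integral bounds the mass in question.\<close>
    let ?f = "cutoff (window m) z (4 / r)" and ?A = "{x. r \<le> seq_dist UNIV x (\<lambda>_. z)}"
    have "emeasure \<kappa>' ?A = (\<integral>\<^sup>+x. indicator ?A x \<partial>\<kappa>')"
      by (rule nn_integral_indicator[symmetric]) (simp add: sets_\<kappa>')
    also have "\<dots> \<le> (\<integral>\<^sup>+x. ennreal (?f x) \<partial>\<kappa>')"
    proof (rule nn_integral_mono)
      fix x
      have "?f x = 1" if "x \<in> ?A"
        using that m[of x "\<lambda>_. z"] \<open>r > 0\<close> by (intro cutoff_eq_1[of "r / 2"]) auto
      then show "indicator ?A x \<le> ennreal (?f x)"
        by (auto simp: indicator_def)
    qed
    also have "\<dots> = ennreal (\<integral>x. ?f x \<partial>\<kappa> m)"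
      using \<open>r > 0\<close> by (intro pos cutoff_test_fun cutoff_nonneg) auto
    finally show "emeasure \<kappa>' ?A < \<infinity>"
      by (auto simp: less_top[symmetric] top_unique)
  qed
  show ?thesis
  proof (rule that[OF fin'])
    fix m f assume f: "f \<in> test_fun (window m) z"
    have nonneg: "(\<integral>x. f' x \<partial>\<kappa>') = (\<integral>x. f' x \<partial>\<kappa> m)"
      if "f' \<in> test_fun (window m) z" "\<And>x. 0 \<le> f' x" for f'
    proof -
      have "(\<integral>x. f' x \<partial>\<kappa>') = enn2real (\<integral>\<^sup>+x. ennreal (f' x) \<partial>\<kappa>')"
        by (intro integral_eq_nn_integral measurable_test_fun[OF that(1) sets_\<kappa>'] AE_I2 that(2))
      also have "\<dots> = enn2real (ennreal (\<integral>x. f' x \<partial>\<kappa> m))"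
        by (simp only: pos[OF that])
      finally show ?thesis
        using that(2) by (simp add: integral_nonneg)
    qed
    \<comment> \<open>The integral identity for nonnegative functions extends to \<open>f\<close> by
      writing it as \<open>f + |f|\<close> minus \<open>|f|\<close>.\<close>
    have f_pos: "(\<lambda>x. f x + \<bar>f x\<bar>) \<in> test_fun (window m) z"
      by (intro test_fun_add test_fun_abs f)
    have "(\<integral>x. f x \<partial>L) = (\<integral>x. f x + \<bar>f x\<bar> \<partial>L) - (\<integral>x. \<bar>f x\<bar> \<partial>L)"
      if "finite_away (window m) z L" for L
      using integrable_test_fun[OF that f] by simp
    from this[OF fin] this[OF finite_away_mono[OF fin' subset_UNIV]]
    show "(\<integral>x. f x \<partial>\<kappa>') = (\<integral>x. f x \<partial>\<kappa> m)"
      using nonneg[OF f_pos] nonneg[OF test_fun_abs[OF f]] by simp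
  qed
qed

text \<open>By uniqueness the window limits agree on common test functions, so one measure over all
  integers can replace each of them. Convergence over all windows to this single measure then gives
  convergence over all integers.\<close>

lemma seq_tendsto_extend:
  fixes N :: "'i \<Rightarrow> (int \<Rightarrow> 'a::polish_space) measure"
  assumes "F \<noteq> bot" and N: "\<forall>\<^sub>F u in F. finite_measure (N u) \<and> sets (N u) = sets borel"
    and lim: "\<And>m. seq_tendsto (window m) z N (\<kappa> m) F"
  obtains \<kappa>' where "seq_tendsto UNIV z N \<kappa>' F"
proof -
  obtain \<kappa>' where fin: "finite_away UNIV z \<kappa>'"
    and int: "\<And>m f. f \<in> test_fun (window m) z \<Longrightarrow> (\<integral>x. f x \<partial>\<kappa>') = (\<integral>x. f x \<partial>\<kappa> m)"
  proof (rule projective_limit_test_fun[of z \<kappa>])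
    show "finite_away (window m) z (\<kappa> m)" for m
      by (rule seq_tendstoD[OF lim])
    show "(\<integral>x. f x \<partial>\<kappa> k) = (\<integral>x. f x \<partial>\<kappa> m)" if "m \<le> k" "f \<in> test_fun (window m) z" for m k f
      by (rule seq_tendsto_unique[OF lim lim test_fun_mono[OF that(2) window_mono[OF that(1)]] that(2) assms(1)])
  qed (use that in blast)
  have "seq_tendsto (window m) z N \<kappa>' F" for m
    unfolding seq_tendsto_def
    using finite_away_mono[OF fin subset_UNIV] int seq_tendstoD(2)[OF lim] by simp
  then show ?thesis
    using seq_tendsto_UNIV[OF fin _ N] that by blast
qed

section \<open>Null sets off the origin\<close>

lemma off_origin_eq: "{x. \<exists>t\<in>J. x t \<noteq> z} = {x. 0 < seq_dist J x (\<lambda>_. z)}"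
  using seq_dist_eq_0[of J _ "\<lambda>_. z"] seq_dist_nonneg[of J _ "\<lambda>_. z"]
  by (auto simp: less_le)

lemma sets_off_origin [measurable]:
  "{x :: int \<Rightarrow> 'a::metric_space. \<exists>t\<in>J. x t \<noteq> z} \<in> sets borel"
proof -
  have "(\<lambda>x. seq_dist J x (\<lambda>_. z)) -` {0<..} \<inter> space borel \<in> sets borel"
    by (rule measurable_sets[OF measurable_seq_dist]) simp
  then show ?thesis
    unfolding off_origin_eq by (simp add: vimage_def)
qed

text \<open>Wherever the distance is positive, a cutoff with large enough integer slope is 1, so the
  cutoffs together detect any mass off the origin. The criterion uses integrals of test functions
  alone and can therefore be passed between limits.\<close>

lemma emeasure_off_origin_eq_0_iff:
  assumes fin: "finite_away J z \<kappa>"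
  shows "emeasure \<kappa> {x. \<exists>t\<in>J. x t \<noteq> z} = 0 \<longleftrightarrow> (\<forall>c\<ge>0. (\<integral>x. cutoff J z c x \<partial>\<kappa>) = 0)"
proof -
  have s: "sets \<kappa> = sets borel"
    using fin by (simp add: finite_away_def)
  then have sp: "space \<kappa> = UNIV"
    using sets_eq_imp_space_eq[OF s] by simp
  have "emeasure \<kappa> {x. \<exists>t\<in>J. x t \<noteq> z} = 0 \<longleftrightarrow> (AE x in \<kappa>. seq_dist J x (\<lambda>_. z) = 0)"
    by (subst AE_iff_measurable[of "{x. \<exists>t\<in>J. x t \<noteq> z}"]) (auto simp: s sp seq_dist_eq_0)
  also have "\<dots> \<longleftrightarrow> (\<forall>c\<ge>0. AE x in \<kappa>. cutoff J z c x = 0)"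
  proof (intro iffI allI impI)
    fix c :: real assume "AE x in \<kappa>. seq_dist J x (\<lambda>_. z) = 0"
    then show "AE x in \<kappa>. cutoff J z c x = 0"
      by eventually_elim (simp add: cutoff_def)
  next
    assume "\<forall>c\<ge>0. AE x in \<kappa>. cutoff J z c x = 0"
    then have "AE x in \<kappa>. \<forall>n::nat. cutoff J z (real n) x = 0"
      by (simp add: AE_all_countable)
    then show "AE x in \<kappa>. seq_dist J x (\<lambda>_. z) = 0"
    proof eventually_elim
      case (elim x)
      obtain n where n: "2 / seq_dist J x (\<lambda>_. z) \<le> real n"
        using real_arch_simple by blast
      show ?case
      proof (rule ccontr)
        assume "seq_dist J x (\<lambda>_. z) \<noteq> 0"
        then have "0 < seq_dist J x (\<lambda>_. z)"
          by (simp add: less_le)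
        then show False
          using cutoff_eq_1[OF _ order_refl n] elim by simp
      qed
    qed
  qed
  also have "\<dots> \<longleftrightarrow> (\<forall>c\<ge>0. (\<integral>x. cutoff J z c x \<partial>\<kappa>) = 0)"
  proof (intro all_cong1 imp_cong refl)
    fix c :: real assume "0 \<le> c"
    then have "integrable \<kappa> (cutoff J z c)"
      by (intro integrable_test_fun[OF fin] cutoff_test_fun)
    then show "(AE x in \<kappa>. cutoff J z c x = 0) \<longleftrightarrow> (\<integral>x. cutoff J z c x \<partial>\<kappa>) = 0"
      by (intro integral_nonneg_eq_0_iff_AE[symmetric]) (auto simp: cutoff_nonneg)
  qed
  finally show ?thesis .
qed

subsection \<open>Punctured sequence spaces\<close>

text \<open>Open sets of a subspace are traces of open sets, hence lie in the trace sigma-algebra.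
  This serves maps that are continuous only off the origin.\<close>

lemma measurable_restrict_borel_of:
  assumes "continuous_map (subtopology T A) T' f"
  shows "f \<in> restrict_space (borel_of T) A \<rightarrow>\<^sub>M borel_of T'"
  unfolding borel_of_def
proof (rule measurable_measure_of)
  let ?M = "restrict_space (sigma (topspace T) {U. openin T U}) A"
  have sub: "{U. openin T U} \<subseteq> Pow (topspace T)" for T :: "'c topology"
    using openin_subset by blast
  show "{U. openin T' U} \<subseteq> Pow (topspace T')"
    by (rule sub)
  have sp: "space ?M = topspace T \<inter> A"
    using sub[of T] by (simp add: space_restrict_space Int_commute)
  show "f \<in> space ?M \<rightarrow> topspace T'"
    using assms unfolding sp continuous_map_def by (auto simp: Pi_iff)
  show "f -` U \<inter> space ?M \<in> sets ?M" if "U \<in> {U. openin T' U}" for U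
  proof -
    have "openin (subtopology T A) {x \<in> topspace T \<inter> A. f x \<in> U}"
      using assms that unfolding continuous_map_def by simp
    then obtain W where W: "openin T W" "{x \<in> topspace T \<inter> A. f x \<in> U} = W \<inter> A"
      by (auto simp: openin_subtopology)
    then have "f -` U \<inter> space ?M = A \<inter> W"
      unfolding sp by blast
    moreover have "W \<in> sets (sigma (topspace T) {U. openin T U})"
      using W(1) sub[of T] by (simp add: sigma_sets.Basic)
    ultimately show ?thesis
      unfolding sets_restrict_space by blast
  qed
qed

lemma borel_of_euclidean: "borel_of euclidean = borel"
  by (simp add: borel_of_def borel_def)

lemma space_borel_of: "space (borel_of T) = topspace T"
  unfolding borel_of_def using openin_subset by (intro space_measure_of) blast

lemma sets_borel_of_openin: "openin T U \<Longrightarrow> U \<in> sets (borel_of T)"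
  unfolding borel_of_def using openin_subset by (subst sets_measure_of) auto

lemma measurable_borel_of_continuous:
  assumes "continuous_map T T' f"
  shows "f \<in> borel_of T \<rightarrow>\<^sub>M borel_of T'"
proof -
  have "sets (restrict_space (borel_of T) (topspace T)) = sets (borel_of T)"
    using sets.sets_into_space[of _ "borel_of T"]
    by (auto simp: sets_restrict_space_iff space_borel_of[symmetric])
  then have "measurable (restrict_space (borel_of T) (topspace T)) (borel_of T') = borel_of T \<rightarrow>\<^sub>M borel_of T'"
    by (rule measurable_cong_sets) simp
  then show ?thesis
    using measurable_restrict_borel_of[of T "topspace T" T' f] assms by simp
qed

text \<open>Scaling a measure is the same as giving it a constant density.\<close>

lemma integral_scale_measure:
  fixes f :: "'b \<Rightarrow> real"
  assumes "f \<in> borel_measurable M" "0 \<le> r"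
  shows "(\<integral>x. f x \<partial>scale_measure (ennreal r) M) = r * (\<integral>x. f x \<partial>M)"
proof -
  have "scale_measure (ennreal r) M = density M (\<lambda>_. ennreal r)"
    by (rule measure_eqI) (simp_all add: emeasure_density_const)
  then show ?thesis
    using assms by (simp add: integral_real_density)
qed

lemma continuous_map_fill:
  "continuous_map (product_topology (\<lambda>_. euclidean) J) euclidean
    (fill J z :: (int \<Rightarrow> 'a::topological_space) \<Rightarrow> _)"
  unfolding euclidean_product_topology[symmetric] continuous_map_componentwise_UNIV
proof
  fix t
  show "continuous_map (product_topology (\<lambda>_. euclidean) J) euclidean (\<lambda>x. fill J z x t)"
    unfolding fill_def by (cases "t \<in> J") (auto intro: continuous_map_product_projection)
qed

lemma fill_off_origin:
  assumes "x \<in> (\<Pi>\<^sub>E t\<in>J. UNIV)"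
  shows "(\<exists>t\<in>J. fill J z x t \<noteq> z) \<longleftrightarrow> x \<noteq> seq_origin J z"
  using assms unfolding seq_origin_def fill_def
  by (auto simp: fun_eq_iff PiE_iff extensional_def restrict_def)

lemma restrict_off_origin: "restrict x J \<noteq> seq_origin J z \<longleftrightarrow> (\<exists>t\<in>J. x t \<noteq> z)"
  by (auto simp: fun_eq_iff restrict_def seq_origin_def)

lemma seq_dist_fill: "seq_dist J (fill J z x) (\<lambda>_. z) = seq_dist J x (seq_origin J z)"
  by (rule seq_dist_cong) (auto simp: fill_def seq_origin_def)

lemma open_off_origin: "open {x :: int \<Rightarrow> 'a::metric_space. \<exists>t\<in>J. x t \<noteq> z}"
  unfolding off_origin_eq by (intro open_Collect_less continuous_intros)

lemma punctured_seq_metric: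
  "punctured (seq_metric J) (seq_origin J (z :: 'a::metric_space)) =
     subtopology (product_topology (\<lambda>_. euclidean) J) ((\<Pi>\<^sub>E t\<in>J. UNIV) - {seq_origin J z})"
  by (simp add: punctured_def mtopology_of_seq_metric)

lemma topspace_punctured_seq_metric:
  "topspace (punctured (seq_metric J) (seq_origin J (z :: 'a::metric_space))) =
    (\<Pi>\<^sub>E t\<in>J. UNIV) - {seq_origin J z}"
  unfolding punctured_seq_metric by (auto simp: topspace_product_topology)

text \<open>The punctured product is the preimage under \<open>fill\<close> of an open set of total
  sequences.\<close>

lemma openin_punctured_seq_metric:
  "openin (product_topology (\<lambda>_. euclidean) J)
     ((\<Pi>\<^sub>E t\<in>J. UNIV) - {seq_origin J (z :: 'a::metric_space)})"
proof -
  have "(\<Pi>\<^sub>E t\<in>J. UNIV) - {seq_origin J z} =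
      {x \<in> topspace (product_topology (\<lambda>_. euclidean) J). fill J z x \<in> {x. \<exists>t\<in>J. x t \<noteq> z}}"
    using fill_off_origin[of _ J z] by (auto simp: topspace_product_topology)
  then show ?thesis
    using openin_continuous_map_preimage[OF continuous_map_fill[of J z], of "{x. \<exists>t\<in>J. x t \<noteq> z}"]
      open_off_origin[of J z] by simp
qed

lemma openin_ball_seq_metric:
  "openin (mtopology_of (seq_metric J))
     {x \<in> (\<Pi>\<^sub>E t\<in>J. UNIV). seq_dist J x (seq_origin J (z :: 'a::metric_space)) < r}"
proof -
  have "open {x :: int \<Rightarrow> 'a. seq_dist J x (\<lambda>_. z) < r}"
    by (intro open_Collect_less continuous_intros)
  then show ?thesis
    using openin_continuous_map_preimage[OF continuous_map_fill[of J z], of "{x. seq_dist J x (\<lambda>_. z) < r}"]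
    by (simp add: mtopology_of_seq_metric seq_dist_fill topspace_product_topology)
qed

text \<open>\<open>M0\<close> speaks of open neighbourhoods of the origin,
  \<open>finite_away\<close> of distances; this leads from the former to the latter.\<close>

lemma openin_seq_metric_ball:
  assumes "openin (mtopology_of (seq_metric J)) U" "y \<in> U"
  obtains r where "r > 0"
    "\<And>x :: int \<Rightarrow> 'a::metric_space. x \<in> (\<Pi>\<^sub>E t\<in>J. UNIV) \<Longrightarrow> seq_dist J x y < r \<Longrightarrow> x \<in> U"
proof -
  interpret Metric_space "(\<Pi>\<^sub>E t\<in>J. UNIV) :: (int \<Rightarrow> 'a) set" "seq_dist J"
    by (rule Metric_space_seq_dist)
  have "mtopology = mtopology_of (seq_metric J)"
    by (simp add: mtopology_of_def)
  then have U: "openin mtopology U"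
    using assms by simp
  then obtain r where "r > 0" "mball y r \<subseteq> U"
    using assms(2) unfolding openin_mtopology by blast
  moreover have "y \<in> (\<Pi>\<^sub>E t\<in>J. UNIV)"
    using U assms(2) unfolding openin_mtopology by blast
  ultimately show ?thesis
    by (intro that) (auto simp: in_mball seq_dist_commute[of J y] subset_iff)
qed

subsection \<open>The scaled process\<close>

text \<open>In contrast to \<open>tail_measure\<close>, one measure on total sequences serves every
  index set. Mass at the origin is kept, as test functions do not see it.\<close>

definition scaled_law ::
    "'w measure \<Rightarrow> (int \<Rightarrow> 'w \<Rightarrow> 'a::metric_space) \<Rightarrow> (real \<Rightarrow> 'a \<Rightarrow> 'a) \<Rightarrow> (real \<Rightarrow> real) \<Rightarrow>
      real \<Rightarrow> (int \<Rightarrow> 'a) measure" where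
  "scaled_law P X smul V u =
     scale_measure (ennreal (1 / V u)) (distr P borel (\<lambda>\<omega> t. smul (inverse u) (X t \<omega>)))"

locale scaled_process = scalar_multiplication origin smul + prob_space P
  for origin :: "'a::polish_space" and smul and P :: "'w measure" +
  fixes X :: "int \<Rightarrow> 'w \<Rightarrow> 'a" and V :: "real \<Rightarrow> real"
  assumes measurable_X [measurable]: "\<And>t. X t \<in> P \<rightarrow>\<^sub>M borel"
    and V_pos: "\<forall>\<^sub>F u in at_top. V u > 0"
begin

abbreviation (input) "N \<equiv> scaled_law P X smul V"
abbreviation (input) "T \<equiv> tail_measure P X smul origin V"

lemma measurable_smul: "0 \<le> a \<Longrightarrow> smul a \<in> borel \<rightarrow>\<^sub>M borel"
  by (intro borel_measurable_continuous_onI continuous_on_compose2[OF smul_continuous, of UNIV "\<lambda>x. (a, x)", simplified]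
      continuous_intros) auto

lemma measurable_scaled: "0 \<le> a \<Longrightarrow> (\<lambda>\<omega> t. smul a (X t \<omega>)) \<in> P \<rightarrow>\<^sub>M borel"
  by (intro measurable_into_borel_fun measurable_compose[OF measurable_X measurable_smul])

lemma eventually_pos: "\<forall>\<^sub>F u in at_top. 0 < u \<and> 0 < V u"
  using V_pos eventually_gt_at_top[of 0] by eventually_elim simp

lemma integral_scaled_law:
  assumes "0 < u" "0 < V u" "f \<in> borel_measurable borel"
  shows "(\<integral>x. f x \<partial>N u) = (\<integral>\<omega>. f (\<lambda>t. smul (inverse u) (X t \<omega>)) \<partial>P) / V u"
proof -
  have "(\<integral>x. f x \<partial>N u) = 1 / V u * (\<integral>x. f x \<partial>distr P borel (\<lambda>\<omega> t. smul (inverse u) (X t \<omega>)))"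
    unfolding scaled_law_def using assms by (intro integral_scale_measure) auto
  then show ?thesis
    using assms measurable_scaled[of "inverse u"] by (simp add: integral_distr)
qed

lemma finite_scaled_law: "\<forall>\<^sub>F u in at_top. finite_measure (N u) \<and> sets (N u) = sets borel"
  using eventually_pos
proof eventually_elim
  case (elim u)
  then have "prob_space (distr P borel (\<lambda>\<omega> t. smul (inverse u) (X t \<omega>)))"
    by (intro prob_space_distr measurable_scaled) simp
  then show ?case
    using prob_space.emeasure_space_1
    by (auto simp: scaled_law_def space_scale_measure intro!: finite_measureI) fastforce
qed

text \<open>Both sides are expectations under \<open>P\<close> divided by \<open>V u\<close>.
  Extending \<open>f\<close> by 0 to the sequences at the origin on \<open>J\<close> accounts for
  the restriction of the law to the punctured space.\<close>

lemma integral_tail_measure: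
  fixes f :: "(int \<Rightarrow> 'a) \<Rightarrow> real"
  assumes u: "0 < u" "0 < V u"
    and f: "continuous_map (punctured (seq_metric J) (seq_origin J origin)) euclideanreal f"
    and g: "g \<in> borel_measurable borel"
      "\<And>x. g x = (if \<exists>t\<in>J. x t \<noteq> origin then f (restrict x J) else 0)"
  shows "(\<integral>x. f x \<partial>T J u) = (\<integral>x. g x \<partial>N u)"
proof -
  let ?B = "borel_of (product_topology (\<lambda>_. euclidean) J) :: (int \<Rightarrow> 'a) measure"
  let ?\<Omega> = "(\<Pi>\<^sub>E t\<in>J. UNIV) - {seq_origin J origin}"
  let ?Y = "\<lambda>\<omega>. restrict (\<lambda>t. smul (inverse u) (X t \<omega>)) J"
  have \<Omega>: "?\<Omega> \<inter> space (distr P ?B ?Y) \<in> sets (distr P ?B ?Y)"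
    using sets_borel_of_openin[OF openin_punctured_seq_metric[of J origin]] by auto
  have Y: "?Y \<in> P \<rightarrow>\<^sub>M ?B"
    using measurable_compose[OF measurable_scaled, OF _ measurable_borel_of_continuous[OF continuous_map_restrict, unfolded borel_of_euclidean]]
      u by simp
  have fm: "f \<in> borel_measurable (restrict_space (distr P ?B ?Y) ?\<Omega>)"
    using measurable_restrict_borel_of[OF f[unfolded punctured_seq_metric]]
    by (simp add: borel_of_euclidean cong: measurable_cong_sets sets_restrict_space_cong)
  have "T J u = scale_measure (ennreal (1 / V u)) (restrict_space (distr P ?B ?Y) ?\<Omega>)"
    unfolding tail_measure_def
    by (simp add: mtopology_of_seq_metric seq_smul_def cong: restrict_cong)
  then have "(\<integral>x. f x \<partial>T J u) = 1 / V u * (\<integral>x. f x \<partial>restrict_space (distr P ?B ?Y) ?\<Omega>)"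
    using u fm by (simp only: integral_scale_measure) (intro integral_scale_measure, auto)
  also have "(\<integral>x. f x \<partial>restrict_space (distr P ?B ?Y) ?\<Omega>) = (\<integral>x. indicator ?\<Omega> x * f x \<partial>distr P ?B ?Y)"
    using integral_restrict_space[OF \<Omega>, of f] by simp
  also have "\<dots> = (\<integral>\<omega>. indicator ?\<Omega> (?Y \<omega>) * f (?Y \<omega>) \<partial>P)"
    using Y borel_measurable_restrict_space_iff[OF \<Omega>, of f] fm by (intro integral_distr) simp_all
  also have "\<dots> = (\<integral>\<omega>. g (\<lambda>t. smul (inverse u) (X t \<omega>)) \<partial>P)"
    by (intro Bochner_Integration.integral_cong refl)
      (auto simp: g(2) restrict_off_origin indicator_def)
  finally show ?thesis
    using integral_scaled_law[OF u g(1)] by simp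
qed

section \<open>Transfer between punctured products and total sequences\<close>

lemma measurable_fill_M0:
  assumes "\<mu> \<in> M0 (seq_metric J) (seq_origin J origin)"
  shows "fill J origin \<in> \<mu> \<rightarrow>\<^sub>M borel"
proof -
  have "continuous_map (punctured (seq_metric J) (seq_origin J origin)) euclidean (fill J origin)"
    unfolding punctured_seq_metric by (intro continuous_map_from_subtopology continuous_map_fill)
  from measurable_borel_of_continuous[OF this] show ?thesis
    using assms by (simp add: M0_def borel_of_euclidean cong: measurable_cong_sets)
qed

lemma space_M0:
  assumes "\<mu> \<in> M0 (seq_metric J) (seq_origin J origin)"
  shows "space \<mu> = (\<Pi>\<^sub>E t\<in>J. UNIV) - {seq_origin J origin}"
  using assms sets_eq_imp_space_eq[of \<mu> "borel_of (punctured (seq_metric J) (seq_origin J origin))"]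
  by (simp add: M0_def space_borel_of topspace_punctured_seq_metric)

text \<open>A test function composed with \<open>fill\<close> is admissible on the punctured space,
  so convergence there yields convergence to the image measure under \<open>fill\<close>.\<close>

lemma M0_tendsto_imp_seq_tendsto:
  assumes \<mu>: "\<mu> \<in> M0 (seq_metric J) (seq_origin J origin)"
    and lim: "M0_tendsto (seq_metric J) (seq_origin J origin) (T J) \<mu> at_top"
  shows "seq_tendsto J origin N (distr \<mu> borel (fill J origin)) at_top"
  unfolding seq_tendsto_def finite_away_def
proof (intro conjI allI impI ballI)
  show "sets (distr \<mu> borel (fill J origin)) = sets borel"
    by simp
next
  fix r :: real assume "r > 0"
  let ?U = "{x \<in> (\<Pi>\<^sub>E t\<in>J. UNIV). seq_dist J x (seq_origin J origin) < r}"
  have "emeasure (distr \<mu> borel (fill J origin)) {x. r \<le> seq_dist J x (\<lambda>_. origin)} =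
      emeasure \<mu> (fill J origin -` {x. r \<le> seq_dist J x (\<lambda>_. origin)} \<inter> space \<mu>)"
    using measurable_fill_M0[OF \<mu>] by (intro emeasure_distr) auto
  also have "fill J origin -` {x. r \<le> seq_dist J x (\<lambda>_. origin)} \<inter> space \<mu> = mspace (seq_metric J) - ?U"
    using \<open>r > 0\<close> by (auto simp: space_M0[OF \<mu>] seq_dist_fill)
  also have "emeasure \<mu> \<dots> < \<infinity>"
  proof -
    have "seq_origin J origin \<in> ?U"
      using \<open>r > 0\<close> by (auto simp: seq_origin_def)
    then show ?thesis
      using \<mu> openin_ball_seq_metric[of J origin r] by (simp add: M0_def)
  qed
  finally show "emeasure (distr \<mu> borel (fill J origin)) {x. r \<le> seq_dist J x (\<lambda>_. origin)} < \<infinity>" .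
next
  fix f assume f: "f \<in> test_fun J origin"
  then show "((\<lambda>u. \<integral>x. f x \<partial>N u) \<longlongrightarrow> (\<integral>x. f x \<partial>distr \<mu> borel (fill J origin))) at_top"
  proof (rule test_funE)
    fix C r assume cont: "continuous_on UNIV f" and C: "\<And>x. \<bar>f x\<bar> \<le> C"
      and cyl: "\<And>x y. (\<And>t. t \<in> J \<Longrightarrow> x t = y t) \<Longrightarrow> f x = f y"
      and r: "r > 0" "\<And>x. seq_dist J x (\<lambda>_. origin) < r \<Longrightarrow> f x = 0"
    let ?f = "\<lambda>x. f (fill J origin x)"
    have c: "continuous_map (punctured (seq_metric J) (seq_origin J origin)) euclideanreal ?f"
    proof -
      have "continuous_map euclidean euclideanreal f"
        using cont by simp
      from continuous_map_compose[OF continuous_map_from_subtopology[OF continuous_map_fill] this]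
      show ?thesis
        unfolding punctured_seq_metric by (simp add: o_def)
    qed
    have "((\<lambda>u. \<integral>x. ?f x \<partial>T J u) \<longlongrightarrow> (\<integral>x. ?f x \<partial>\<mu>)) at_top"
    proof (rule lim[unfolded M0_tendsto_def, rule_format], intro conjI c)
      show "bounded (?f ` (mspace (seq_metric J) - {seq_origin J origin}))"
        using C by (intro boundedI[of _ C]) auto
      show "\<exists>r>0. \<forall>x\<in>mspace (seq_metric J) - {seq_origin J origin}.
          mdist (seq_metric J) x (seq_origin J origin) < r \<longrightarrow> ?f x = 0"
        using r by (intro exI[of _ r]) (auto simp: seq_dist_fill)
    qed
    moreover have "\<forall>\<^sub>F u in at_top. (\<integral>x. ?f x \<partial>T J u) = (\<integral>x. f x \<partial>N u)"
      using eventually_pos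
    proof eventually_elim
      case (elim u)
      show ?case
      proof (rule integral_tail_measure[OF _ _ c])
        fix x
        \<comment> \<open>Such a sequence has distance 0 from the origin over \<open>J\<close>, so
          extension by 0 recovers \<open>f\<close> exactly.\<close>
        have "f x = 0" if "\<not> (\<exists>t\<in>J. x t \<noteq> origin)"
          using that r(1) seq_dist_eq_0[of J x "\<lambda>_. origin"] by (intro r(2)) auto
        then show "f x = (if \<exists>t\<in>J. x t \<noteq> origin then ?f (restrict x J) else 0)"
          using fill_restrict[of J f origin x, OF cyl] by auto
      qed (use elim measurable_test_fun[OF f refl] in auto)
    qed
    moreover have "(\<integral>x. ?f x \<partial>\<mu>) = (\<integral>x. f x \<partial>distr \<mu> borel (fill J origin))"
      by (rule integral_distr[OF measurable_fill_M0[OF \<mu>] measurable_test_fun[OF f refl], symmetric])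
    ultimately show ?thesis
      using tendsto_cong by force
  qed
qed

text \<open>Coordinates outside \<open>J\<close> are filled with the origin, so these events are
  preserved for index sets inside \<open>J\<close>.\<close>

lemma emeasure_distr_fill:
  assumes "\<mu> \<in> M0 (seq_metric J) (seq_origin J origin)" "K \<subseteq> J"
  shows "emeasure (distr \<mu> borel (fill J origin)) {x. \<exists>t\<in>K. x t \<noteq> origin} =
    emeasure \<mu> {x \<in> space \<mu>. \<exists>t\<in>K. x t \<noteq> origin}"
proof -
  have "fill J origin -` {x. \<exists>t\<in>K. x t \<noteq> origin} \<inter> space \<mu> = {x \<in> space \<mu>. \<exists>t\<in>K. x t \<noteq> origin}"
    using assms(2) by (auto simp: fill_def subset_iff)
  then show ?thesis
    using measurable_fill_M0[OF assms(1)] by (simp add: emeasure_distr)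
qed

text \<open>The measure is the part of \<open>\<kappa>\<close> off the origin on \<open>J\<close>,
  moved to the punctured product by restriction. The masses of coordinate events are recorded as
  well, because non-vanishing and positivity at coordinate 0 have to survive the transfer.\<close>

lemma seq_tendsto_imp_M0_tendsto:
  assumes lim: "seq_tendsto J origin N \<kappa> at_top"
  obtains \<mu> where "\<mu> \<in> M0 (seq_metric J) (seq_origin J origin)"
    "M0_tendsto (seq_metric J) (seq_origin J origin) (T J) \<mu> at_top"
    "\<And>K. K \<subseteq> J \<Longrightarrow> emeasure \<mu> {x \<in> space \<mu>. \<exists>t\<in>K. x t \<noteq> origin} = emeasure \<kappa> {x. \<exists>t\<in>K. x t \<noteq> origin}"
proof -
  let ?A = "{x. \<exists>t\<in>J. x t \<noteq> origin}"
  let ?T = "punctured (seq_metric J) (seq_origin J origin)"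
  let ?r = "\<lambda>x. restrict x J"
  have s: "sets \<kappa> = sets borel"
    and fin: "\<And>r. r > 0 \<Longrightarrow> emeasure \<kappa> {x. r \<le> seq_dist J x (\<lambda>_. origin)} < \<infinity>"
    using seq_tendstoD(1)[OF lim] by (auto simp: finite_away_def)
  have sp: "space \<kappa> = UNIV"
    using sets_eq_imp_space_eq[OF s] by simp
  have A: "?A \<inter> space \<kappa> \<in> sets \<kappa>"
    by (simp add: s sp sets_off_origin)
  have cr: "continuous_map (subtopology euclidean ?A) ?T ?r"
    unfolding punctured_seq_metric
    by (intro continuous_map_into_subtopology continuous_map_from_subtopology continuous_map_restrict)
      (use restrict_off_origin[of _ J origin] in auto)
  have mr: "?r \<in> restrict_space \<kappa> ?A \<rightarrow>\<^sub>M borel_of ?T"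
    using measurable_restrict_borel_of[OF cr] s
    by (simp add: borel_of_euclidean cong: measurable_cong_sets sets_restrict_space_cong)
  define \<mu> where "\<mu> = distr (restrict_space \<kappa> ?A) (borel_of ?T) ?r"
  have em: "emeasure \<mu> B = emeasure \<kappa> {x \<in> ?A. restrict x J \<in> B}" if "B \<in> sets (borel_of ?T)" for B
  proof -
    have "emeasure \<mu> B = emeasure (restrict_space \<kappa> ?A) (?r -` B \<inter> space (restrict_space \<kappa> ?A))"
      unfolding \<mu>_def using mr that by (rule emeasure_distr)
    also have "?r -` B \<inter> space (restrict_space \<kappa> ?A) = {x \<in> ?A. restrict x J \<in> B}"
      by (auto simp: space_restrict_space sp)
    also have "emeasure (restrict_space \<kappa> ?A) \<dots> = emeasure \<kappa> {x \<in> ?A. restrict x J \<in> B}"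
      using A by (intro emeasure_restrict_space) auto
    finally show ?thesis .
  qed
  have sets_\<mu>: "sets \<mu> = sets (borel_of ?T)"
    by (simp add: \<mu>_def)
  have space_\<mu>: "space \<mu> = (\<Pi>\<^sub>E t\<in>J. UNIV) - {seq_origin J origin}"
    by (simp add: \<mu>_def space_borel_of topspace_punctured_seq_metric)
  show ?thesis
  proof (rule that[of \<mu>])
    show "\<mu> \<in> M0 (seq_metric J) (seq_origin J origin)"
      unfolding M0_def
    proof (intro CollectI conjI allI impI sets_\<mu>)
      fix U assume U: "openin (mtopology_of (seq_metric J)) U \<and> seq_origin J origin \<in> U"
      then obtain r where r: "r > 0" "\<And>x. x \<in> (\<Pi>\<^sub>E t\<in>J. UNIV) \<Longrightarrow> seq_dist J x (seq_origin J origin) < r \<Longrightarrow> x \<in> U"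
        using openin_seq_metric_ball[of J U "seq_origin J origin"] by blast
      have "openin ?T (U \<inter> ((\<Pi>\<^sub>E t\<in>J. UNIV) - {seq_origin J origin}))"
        using U unfolding punctured_seq_metric mtopology_of_seq_metric by (auto intro: openin_subtopology_Int)
      then have "space (borel_of ?T) - (U \<inter> ((\<Pi>\<^sub>E t\<in>J. UNIV) - {seq_origin J origin})) \<in> sets (borel_of ?T)"
        by (intro sets.compl_sets sets_borel_of_openin)
      also have "space (borel_of ?T) - (U \<inter> ((\<Pi>\<^sub>E t\<in>J. UNIV) - {seq_origin J origin})) = mspace (seq_metric J) - U"
        using U by (auto simp: space_borel_of topspace_punctured_seq_metric)
      finally have "emeasure \<mu> (mspace (seq_metric J) - U) = emeasure \<kappa> {x \<in> ?A. restrict x J \<in> mspace (seq_metric J) - U}"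
        by (rule em)
      also have "\<dots> \<le> emeasure \<kappa> {x. r \<le> seq_dist J x (\<lambda>_. origin)}"
      proof (rule emeasure_mono)
        show "{x. r \<le> seq_dist J x (\<lambda>_. origin)} \<in> sets \<kappa>"
          unfolding s by measurable
        show "{x \<in> ?A. restrict x J \<in> mspace (seq_metric J) - U} \<subseteq> {x. r \<le> seq_dist J x (\<lambda>_. origin)}"
        proof safe
          fix x assume "restrict x J \<notin> U"
          then have "\<not> seq_dist J (restrict x J) (restrict (\<lambda>_. origin) J) < r"
            using r(2)[of "restrict x J"] by (auto simp: seq_origin_def)
          then show "r \<le> seq_dist J x (\<lambda>_. origin)"
            by simp
        qed
      qed
      also have "\<dots> < \<infinity>"
        using r(1) by (rule fin)
      finally show "emeasure \<mu> (mspace (seq_metric J) - U) < \<infinity>" .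
    qed
  next
    fix K assume "K \<subseteq> J"
    have "{x \<in> space \<mu>. \<exists>t\<in>K. x t \<noteq> origin} = {x \<in> space \<mu>. fill J origin x \<in> {x. \<exists>t\<in>K. x t \<noteq> origin}}"
      using \<open>K \<subseteq> J\<close> by (auto simp: fill_def subset_iff)
    also have "\<dots> \<in> sets (borel_of ?T)"
    proof -
      have "continuous_map ?T euclidean (fill J origin)"
        unfolding punctured_seq_metric by (intro continuous_map_from_subtopology continuous_map_fill)
      from openin_continuous_map_preimage[OF this, of "{x. \<exists>t\<in>K. x t \<noteq> origin}"]
      show ?thesis
        by (intro sets_borel_of_openin)
          (simp add: open_off_origin space_\<mu> topspace_punctured_seq_metric)
    qed
    finally have "emeasure \<mu> {x \<in> space \<mu>. \<exists>t\<in>K. x t \<noteq> origin} =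
        emeasure \<kappa> {x \<in> ?A. restrict x J \<in> {x \<in> space \<mu>. \<exists>t\<in>K. x t \<noteq> origin}}"
      by (rule em)
    also have "{x \<in> ?A. restrict x J \<in> {x \<in> space \<mu>. \<exists>t\<in>K. x t \<noteq> origin}} = {x. \<exists>t\<in>K. x t \<noteq> origin}"
      using \<open>K \<subseteq> J\<close> restrict_off_origin[of _ J origin] by (auto simp: space_\<mu> subset_iff)
    finally show "emeasure \<mu> {x \<in> space \<mu>. \<exists>t\<in>K. x t \<noteq> origin} = emeasure \<kappa> {x. \<exists>t\<in>K. x t \<noteq> origin}" .
  next
    show "M0_tendsto (seq_metric J) (seq_origin J origin) (T J) \<mu> at_top"
      unfolding M0_tendsto_def
    proof (intro allI impI, elim conjE exE)
      fix f :: "(int \<Rightarrow> 'a) \<Rightarrow> real" and r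
      assume f: "continuous_map ?T euclideanreal f"
        and bdd: "bounded (f ` (mspace (seq_metric J) - {seq_origin J origin}))"
        and r: "r > 0" "\<forall>x\<in>mspace (seq_metric J) - {seq_origin J origin}.
          mdist (seq_metric J) x (seq_origin J origin) < r \<longrightarrow> f x = 0"
      define g where "g x = (if \<exists>t\<in>J. x t \<noteq> origin then f (restrict x J) else 0)" for x
      have vanish: "g x = 0" if "seq_dist J x (\<lambda>_. origin) < r" for x
      proof (cases "\<exists>t\<in>J. x t \<noteq> origin")
        case True
        have "seq_dist J (restrict x J) (restrict (\<lambda>_. origin) J) < r"
          using that by simp
        then have "f (restrict x J) = 0"
          using r(2) True restrict_off_origin[of x J origin] by (auto simp: seq_origin_def)
        then show ?thesis by (simp add: g_def)
      qed (simp add: g_def)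
      have "g \<in> test_fun J origin"
      proof -
        obtain C where C: "0 \<le> C" "\<And>x. x \<in> mspace (seq_metric J) - {seq_origin J origin} \<Longrightarrow> \<bar>f x\<bar> \<le> C"
        proof -
          obtain B where "\<forall>x\<in>mspace (seq_metric J) - {seq_origin J origin}. \<bar>f x\<bar> \<le> B"
            using bdd unfolding bounded_iff by auto
          then show ?thesis
            by (intro that[of "max 0 B"]) (auto simp: le_max_iff_disj)
        qed
        \<comment> \<open>Continuity is glued from two open sets that cover everything: off the
          origin \<open>g\<close> is \<open>f\<close> after restriction, and near the origin it is
          0.\<close>
        have "continuous_on (?A \<union> {x. seq_dist J x (\<lambda>_. origin) < r}) g"
        proof (rule continuous_on_open_Un)
          have "continuous_map (subtopology euclidean ?A) euclideanreal (f \<circ> ?r)"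
            by (rule continuous_map_compose[OF cr f])
          then have "continuous_on ?A (f \<circ> ?r)"
            by simp
          then show "continuous_on ?A g"
            by (rule continuous_on_eq) (auto simp: g_def)
          have "continuous_on {x. seq_dist J x (\<lambda>_. origin) < r} (\<lambda>_. 0 :: real)"
            by simp
          then show "continuous_on {x. seq_dist J x (\<lambda>_. origin) < r} g"
            by (rule continuous_on_eq) (simp add: vanish)
        qed (auto intro!: open_off_origin open_Collect_less continuous_intros)
        moreover have "?A \<union> {x. seq_dist J x (\<lambda>_. origin) < r} = UNIV"
          unfolding off_origin_eq using r(1) by auto
        ultimately have "continuous_on UNIV g"
          by simp
        then show ?thesis
        proof (rule test_funI)
          show "\<bar>g x\<bar> \<le> C" for x
            using C restrict_off_origin[of x J origin] by (auto simp: g_def)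
          show "g x = g y" if "\<And>t. t \<in> J \<Longrightarrow> x t = y t" for x y
          proof -
            have "restrict x J = restrict y J"
              using that by (rule restrict_ext)
            then show ?thesis
              using that by (simp add: g_def)
          qed
        qed (use r vanish in auto)
      qed
      then have gm: "g \<in> borel_measurable borel" and "((\<lambda>u. \<integral>x. g x \<partial>N u) \<longlongrightarrow> (\<integral>x. g x \<partial>\<kappa>)) at_top"
        by (rule measurable_test_fun[OF _ refl], rule seq_tendstoD(2)[OF lim])
      moreover have "\<forall>\<^sub>F u in at_top. (\<integral>x. f x \<partial>T J u) = (\<integral>x. g x \<partial>N u)"
        using eventually_pos by eventually_elim (intro integral_tail_measure f gm g_def; simp)
      moreover have "(\<integral>x. f x \<partial>\<mu>) = (\<integral>x. g x \<partial>\<kappa>)"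
      proof -
        have "(\<integral>x. f x \<partial>\<mu>) = (\<integral>x. f (restrict x J) \<partial>restrict_space \<kappa> ?A)"
          unfolding \<mu>_def using mr measurable_borel_of_continuous[OF f]
          by (intro integral_distr) (simp_all add: borel_of_euclidean)
        also have "\<dots> = (\<integral>x. indicator ?A x * f (restrict x J) \<partial>\<kappa>)"
          using integral_restrict_space[OF A, of "\<lambda>x. f (restrict x J)"] by simp
        also have "\<dots> = (\<integral>x. g x \<partial>\<kappa>)"
          by (intro Bochner_Integration.integral_cong) (auto simp: g_def)
        finally show ?thesis .
      qed
      ultimately show "((\<lambda>u. \<integral>x. f x \<partial>T J u) \<longlongrightarrow> (\<integral>x. f x \<partial>\<mu>)) at_top"
        using tendsto_cong by force
    qed
  qed
qed

text \<open>By stationarity, cutoffs of coordinate \<open>h\<close> and of coordinate 0 have the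
  same integrals before the limit, hence also in the limit. So every single coordinate is almost
  everywhere at the origin, and there are countably many of them.\<close>

lemma stationary_off_origin:
  assumes stat: "strictly_stationary P X" and lim: "seq_tendsto UNIV origin N \<kappa> at_top"
    and zero: "emeasure \<kappa> {x. \<exists>t\<in>{0}. x t \<noteq> origin} = 0"
  shows "emeasure \<kappa> {x. \<exists>t\<in>UNIV. x t \<noteq> origin} = 0"
proof -
  have fin: "finite_away J origin \<kappa>" for J
    using finite_away_mono[OF seq_tendstoD(1)[OF lim]] by simp
  have sd: "seq_dist {h} x y = 2 powi (- \<bar>h\<bar>) * (dist (x h) (y h) / (1 + dist (x h) (y h)))"
    for h and x y :: "int \<Rightarrow> 'a"
    by (simp add: seq_dist_def)
  have "emeasure \<kappa> {x. \<exists>t\<in>{h}. x t \<noteq> origin} = 0" for h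
    unfolding emeasure_off_origin_eq_0_iff[OF fin]
  proof (intro allI impI)
    fix c :: real assume "0 \<le> c"
    \<comment> \<open>The weight of coordinate \<open>h\<close> in the metric is moved into the
      slope, so that both cutoffs become the same function \<open>G\<close> of one
      coordinate.\<close>
    define w where "w = 2 powi (- \<bar>h\<bar>) * c"
    have w: "0 \<le> w"
      using \<open>0 \<le> c\<close> by (simp add: w_def)
    define G where "G a = cutoff {0} origin w (\<lambda>_. a)" for a
    have f0: "cutoff {0} origin w x = G (x 0)" for x
      unfolding G_def cutoff_def sd by simp
    have fh: "cutoff {h} origin c x = G (x h)" for x
      unfolding G_def cutoff_def sd w_def by (simp add: mult_ac)
    have tf: "cutoff {0} origin w \<in> test_fun UNIV origin" "cutoff {h} origin c \<in> test_fun UNIV origin"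
      using cutoff_test_fun[OF w] cutoff_test_fun[OF \<open>0 \<le> c\<close>] test_fun_mono by blast+
    have Gm: "G \<in> borel_measurable borel"
      unfolding G_def
      by (rule measurable_compose[OF measurable_into_borel_fun measurable_test_fun[OF tf(1) refl]]) simp
    have "\<forall>\<^sub>F u in at_top. (\<integral>x. cutoff {h} origin c x \<partial>N u) = (\<integral>x. cutoff {0} origin w x \<partial>N u)"
      using eventually_pos
    proof eventually_elim
      case (elim u)
      let ?s = "smul (inverse u)"
      let ?B = "PiM {0} (\<lambda>_. borel :: 'a measure) :: (int \<Rightarrow> 'a) measure"
      let ?F = "\<lambda>y. G (?s (y 0))"
      have s: "?s \<in> borel \<rightarrow>\<^sub>M borel"
        using elim by (intro measurable_smul) simp
      have F: "?F \<in> borel_measurable ?B"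
        by (rule measurable_compose[OF _ measurable_compose[OF s Gm]]) simp
      \<comment> \<open>The law of coordinate \<open>k\<close> appears as the marginal over
        \<open>{0}\<close> of the process shifted by \<open>k\<close>, the form in which
        stationarity can be applied.\<close>
      have "(\<integral>\<omega>. G (?s (X (0 + k) \<omega>)) \<partial>P) = (\<integral>y. ?F y \<partial>distr P ?B (\<lambda>\<omega>. \<lambda>t\<in>{0}. X (t + k) \<omega>))" for k
        by (subst integral_distr[OF _ F]) (auto intro: measurable_restrict)
      from this[of h] this[of 0]
      have "(\<integral>\<omega>. G (?s (X h \<omega>)) \<partial>P) = (\<integral>\<omega>. G (?s (X 0 \<omega>)) \<partial>P)"
        using stat[unfolded strictly_stationary_def, rule_format, of "{0}" h] by simp
      then show ?case
        using elim integral_scaled_law[of u, OF _ _ measurable_test_fun[OF tf(1) refl]]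
          integral_scaled_law[of u, OF _ _ measurable_test_fun[OF tf(2) refl]]
        by (simp add: f0 fh)
    qed
    then have "((\<lambda>u. \<integral>x. cutoff {0} origin w x \<partial>N u) \<longlongrightarrow> (\<integral>x. cutoff {h} origin c x \<partial>\<kappa>)) at_top"
      using seq_tendstoD(2)[OF lim tf(2)] tendsto_cong by force
    then have "(\<integral>x. cutoff {h} origin c x \<partial>\<kappa>) = (\<integral>x. cutoff {0} origin w x \<partial>\<kappa>)"
      using seq_tendstoD(2)[OF lim tf(1)] by (intro tendsto_unique[of at_top]) auto
    then show "(\<integral>x. cutoff {h} origin c x \<partial>\<kappa>) = 0"
      using zero w unfolding emeasure_off_origin_eq_0_iff[OF fin] by simp
  qed
  then have "{x. \<exists>t\<in>{h}. x t \<noteq> origin} \<in> null_sets \<kappa>" for h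
    using fin[of UNIV] sets_off_origin[of "{h}" origin] by (intro null_setsI) (auto simp: finite_away_def)
  then have "(\<Union>h. {x. \<exists>t\<in>{h}. x t \<noteq> origin}) \<in> null_sets \<kappa>"
    by (rule null_sets_UN)
  also have "(\<Union>h. {x. \<exists>t\<in>{h}. x t \<noteq> origin}) = {x. \<exists>t\<in>UNIV. x t \<noteq> origin}"
    by auto
  finally show ?thesis
    by (rule null_setsD1)
qed

end

text \<open>The cutoffs over \<open>J\<close> are test functions for both index sets and decide
  whether there is mass off the origin on \<open>J\<close>.\<close>

lemma seq_tendsto_off_origin:
  assumes "seq_tendsto J z N \<kappa> F" "seq_tendsto K z N \<kappa>' F" "J \<subseteq> K" "F \<noteq> bot"
  shows "emeasure \<kappa> {x. \<exists>t\<in>J. x t \<noteq> z} = 0 \<longleftrightarrow> emeasure \<kappa>' {x. \<exists>t\<in>J. x t \<noteq> z} = 0"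
proof -
  have "(\<integral>x. cutoff J z c x \<partial>\<kappa>) = (\<integral>x. cutoff J z c x \<partial>\<kappa>')" if "0 \<le> c" for c
    using cutoff_test_fun[OF that] test_fun_mono[OF cutoff_test_fun[OF that] assms(3)]
    by (rule seq_tendsto_unique[OF assms(1,2) _ _ assms(4)])
  then show ?thesis
    unfolding emeasure_off_origin_eq_0_iff[OF seq_tendstoD(1)[OF assms(1)]]
      emeasure_off_origin_eq_0_iff[OF finite_away_mono[OF seq_tendstoD(1)[OF assms(2)] assms(3)]]
    by simp
qed

section \<open>Equivalence of convergence over all integers and over all windows\<close>

theorem theorem4p1:
  fixes origin :: "'a::polish_space" and smul :: "real \<Rightarrow> 'a \<Rightarrow> 'a"
    and P :: "'w measure" and X :: "int \<Rightarrow> 'w \<Rightarrow> 'a"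
    and \<alpha> :: real and V :: "real \<Rightarrow> real"
  assumes "scalar_multiplication origin smul"
    and "prob_space P"
    and "\<And>t. X t \<in> P \<rightarrow>\<^sub>M borel"
    and "\<alpha> > 0"
    and "V \<in> regularly_varying (- \<alpha>)"
  shows "((\<exists>\<mu> \<in> M0 (seq_metric UNIV) (seq_origin UNIV origin).
            emeasure \<mu> {x. x 0 \<noteq> origin} > 0 \<and>
            M0_tendsto (seq_metric UNIV) (seq_origin UNIV origin)
              (tail_measure P X smul origin V UNIV) \<mu> at_top)
         \<longleftrightarrow>
         (\<forall>m. \<exists>\<mu> \<in> M0 (seq_metric (window m)) (seq_origin (window m) origin).
            emeasure \<mu> (space \<mu>) \<noteq> 0 \<and>
            M0_tendsto (seq_metric (window m)) (seq_origin (window m) origin)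
              (tail_measure P X smul origin V (window m)) \<mu> at_top))
         \<and>
         (strictly_stationary P X \<longrightarrow>
         (\<forall>\<mu> \<in> M0 (seq_metric UNIV) (seq_origin UNIV origin).
           M0_tendsto (seq_metric UNIV) (seq_origin UNIV origin)
             (tail_measure P X smul origin V UNIV) \<mu> at_top \<longrightarrow>
           (emeasure \<mu> {x. x 0 \<noteq> origin} > 0 \<longleftrightarrow> emeasure \<mu> (space \<mu>) \<noteq> 0)))"
    (is "(?a \<longleftrightarrow> ?b) \<and> (_ \<longrightarrow> ?c)")
proof -
  obtain a where "\<forall>u>a. V u > 0"
    using assms(5) unfolding regularly_varying_def by blast
  then have "\<forall>\<^sub>F u in at_top. V u > 0"
    unfolding eventually_at_top_dense by blast
  with assms interpret scaled_process origin smul P X V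
    by (intro scaled_process.intro scaled_process_axioms.intro)
  let ?A = "\<lambda>J. {x. \<exists>t\<in>J. x t \<noteq> origin}"
  \<comment> \<open>Every point of a punctured space is off the origin, so being non-zero becomes a
    statement about one of the recorded coordinate events.\<close>
  have space_eq: "{x \<in> space \<mu>. \<exists>t\<in>J. x t \<noteq> origin} = space \<mu>"
    if "\<mu> \<in> M0 (seq_metric J) (seq_origin J origin)" for \<mu> J
  proof -
    have "\<exists>t\<in>J. x t \<noteq> origin" if "x \<in> (\<Pi>\<^sub>E t\<in>J. UNIV) - {seq_origin J origin}" for x
      using that restrict_off_origin[of x J origin] PiE_restrict[of x J "\<lambda>_. UNIV"] by auto
    then show ?thesis
      by (auto simp: space_M0[OF that])
  qed
  have zero_eq: "{x \<in> space \<mu>. \<exists>t\<in>{0}. x t \<noteq> origin} = {x. x 0 \<noteq> origin}"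
    if "\<mu> \<in> M0 (seq_metric UNIV) (seq_origin UNIV origin)" for \<mu>
    by (auto simp: space_M0[OF that] seq_origin_def)
  have w0: "{0} \<subseteq> window m" "window 0 = {0}" for m
    by (auto simp: window_def)
  show ?thesis
  proof (intro conjI iffI impI)
    assume ?a
    then obtain \<mu> where \<mu>: "\<mu> \<in> M0 (seq_metric UNIV) (seq_origin UNIV origin)"
      "emeasure \<mu> {x. x 0 \<noteq> origin} > 0"
      "M0_tendsto (seq_metric UNIV) (seq_origin UNIV origin) (T UNIV) \<mu> at_top"
      by blast
    define \<kappa> where "\<kappa> = distr \<mu> borel (fill UNIV origin)"
    have lim: "seq_tendsto UNIV origin N \<kappa> at_top"
      unfolding \<kappa>_def using \<mu>(1,3) by (rule M0_tendsto_imp_seq_tendsto)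
    have pos: "emeasure \<kappa> (?A {0}) > 0"
      using \<mu>(2) by (simp only: \<kappa>_def emeasure_distr_fill[OF \<mu>(1) subset_UNIV] zero_eq[OF \<mu>(1)])
    show ?b
    proof
      fix m
      have "seq_tendsto (window m) origin N \<kappa> at_top"
        using lim by (rule seq_tendsto_mono) simp
      then obtain \<nu> where \<nu>: "\<nu> \<in> M0 (seq_metric (window m)) (seq_origin (window m) origin)"
        "M0_tendsto (seq_metric (window m)) (seq_origin (window m) origin) (T (window m)) \<nu> at_top"
        "\<And>K. K \<subseteq> window m \<Longrightarrow> emeasure \<nu> {x \<in> space \<nu>. \<exists>t\<in>K. x t \<noteq> origin} = emeasure \<kappa> (?A K)"
        by (rule seq_tendsto_imp_M0_tendsto) blast
      \<comment> \<open>Every window contains 0, so positive mass at coordinate 0 makes each window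
        limit non-zero.\<close>
      have "emeasure \<kappa> (?A {0}) \<le> emeasure \<kappa> (?A (window m))"
        using w0(1)[of m] by (intro emeasure_mono) (auto simp: \<kappa>_def sets_off_origin)
      also have "\<dots> = emeasure \<nu> (space \<nu>)"
        using \<nu>(3)[OF order_refl] by (simp only: space_eq[OF \<nu>(1)])
      finally have "emeasure \<nu> (space \<nu>) \<noteq> 0"
        using pos by auto
      with \<nu>(1,2) show "\<exists>\<mu> \<in> M0 (seq_metric (window m)) (seq_origin (window m) origin).
          emeasure \<mu> (space \<mu>) \<noteq> 0 \<and>
          M0_tendsto (seq_metric (window m)) (seq_origin (window m) origin) (T (window m)) \<mu> at_top"
        by blast
    qed
  next
    assume ?b
    then obtain \<mu> where \<mu>: "\<And>m. \<mu> m \<in> M0 (seq_metric (window m)) (seq_origin (window m) origin)"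
      "\<And>m. emeasure (\<mu> m) (space (\<mu> m)) \<noteq> 0"
      "\<And>m. M0_tendsto (seq_metric (window m)) (seq_origin (window m) origin) (T (window m)) (\<mu> m) at_top"
      by metis
    define \<kappa> where "\<kappa> m = distr (\<mu> m) borel (fill (window m) origin)" for m
    have lim_m: "seq_tendsto (window m) origin N (\<kappa> m) at_top" for m
      unfolding \<kappa>_def using \<mu>(1,3) by (rule M0_tendsto_imp_seq_tendsto)
    obtain \<kappa>' where lim: "seq_tendsto UNIV origin N \<kappa>' at_top"
      using seq_tendsto_extend[OF trivial_limit_at_top_linorder finite_scaled_law lim_m] .
    then obtain \<nu> where \<nu>: "\<nu> \<in> M0 (seq_metric UNIV) (seq_origin UNIV origin)"
      "M0_tendsto (seq_metric UNIV) (seq_origin UNIV origin) (T UNIV) \<nu> at_top"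
      "\<And>K. K \<subseteq> UNIV \<Longrightarrow> emeasure \<nu> {x \<in> space \<nu>. \<exists>t\<in>K. x t \<noteq> origin} = emeasure \<kappa>' (?A K)"
      by (rule seq_tendsto_imp_M0_tendsto) blast
    \<comment> \<open>Since \<open>window 0\<close> is \<open>{0}\<close>, non-vanishing of the
      limit over it is exactly positivity at coordinate 0.\<close>
    have "emeasure (\<kappa> 0) (?A (window 0)) \<noteq> 0"
      unfolding \<kappa>_def emeasure_distr_fill[OF \<mu>(1) order_refl] space_eq[OF \<mu>(1)] by (rule \<mu>(2))
    then have "emeasure \<kappa>' (?A (window 0)) \<noteq> 0"
      using seq_tendsto_off_origin[OF lim_m lim, of 0] by simp
    then have "emeasure \<nu> {x. x 0 \<noteq> origin} > 0"
      using \<nu>(3)[OF subset_UNIV, of "{0}"] by (simp only: zero_eq[OF \<nu>(1)] w0(2) zero_less_iff_neq_zero not_False_eq_True)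
    with \<nu>(1,2) show ?a
      by blast
  next
    assume stat: "strictly_stationary P X"
    show ?c
    proof (intro ballI impI)
      fix \<mu> assume \<mu>: "\<mu> \<in> M0 (seq_metric UNIV) (seq_origin UNIV origin)"
        "M0_tendsto (seq_metric UNIV) (seq_origin UNIV origin) (T UNIV) \<mu> at_top"
      define \<kappa> where "\<kappa> = distr \<mu> borel (fill UNIV origin)"
      have lim: "seq_tendsto UNIV origin N \<kappa> at_top"
        unfolding \<kappa>_def using \<mu> by (rule M0_tendsto_imp_seq_tendsto)
      \<comment> \<open>One direction is monotonicity of the measure; the other is where
        stationarity enters.\<close>
      have "emeasure \<kappa> (?A {0}) = 0 \<longleftrightarrow> emeasure \<kappa> (?A UNIV) = 0"
      proof
        assume "emeasure \<kappa> (?A UNIV) = 0"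
        moreover have "emeasure \<kappa> (?A {0}) \<le> emeasure \<kappa> (?A UNIV)"
          by (intro emeasure_mono) (auto simp: \<kappa>_def intro: sets_off_origin)
        ultimately show "emeasure \<kappa> (?A {0}) = 0"
          by simp
      qed (rule stationary_off_origin[OF stat lim])
      moreover have "emeasure \<kappa> (?A {0}) = emeasure \<mu> {x. x 0 \<noteq> origin}"
        by (simp only: \<kappa>_def emeasure_distr_fill[OF \<mu>(1) subset_UNIV] zero_eq[OF \<mu>(1)])
      moreover have "emeasure \<kappa> (?A UNIV) = emeasure \<mu> (space \<mu>)"
        by (simp only: \<kappa>_def emeasure_distr_fill[OF \<mu>(1) subset_UNIV] space_eq[OF \<mu>(1)])
      ultimately show "emeasure \<mu> {x. x 0 \<noteq> origin} > 0 \<longleftrightarrow> emeasure \<mu> (space \<mu>) \<noteq> 0"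
        by (simp add: zero_less_iff_neq_zero)
    qed
  qed
qed

end
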